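(* Let $(G,u)\in\mathbf{W}^*$, i.e. $G$ is an Archimedean $\ell$-group and $u\geq 0$ is a strong unit of $G$, regarded as $G\le C(YG)$ via the Yosida representation. The following are equivalent: (1) $G\in(\mathrm{Y})$. (2) For all $g\in G$, $G(g)=I(Z(g))$. (3) For all $g\in G$, $G(g)$ is a $\mathbf{W}^*$-kernel. (4) For all $g\in G$, $G/G(g)$ is Archimedean. (5) The Yosida embedding $G\le C(YG)$ has the property: for all $f,g\in G$, $\mathrm{coz}(f)\subseteq\mathrm{coz}(g)$ implies $f\in G(g)$.
   Context: An ideal of an abelian $\ell$-group $G$ is a convex sub-$\ell$-group. For $g\in G$, $G(g)=\{f\in G : |f|\le n|g| \text{ for some positive integer } n\}$ is the principal ideal. $(G,u)\in\mathbf{W}^*$ means $G$ is an Archimedean $\ell$-group and $u\ge 0$ in $G$ is a strong unit, i.e. $G(u)=G$. A $\mathbf{W}^*$-morphism $(G,u)\to(H,v)$ is an $\ell$-group homomorphism taking $u$ to $v$; a $\mathbf{W}^*$-kernel of $G$ is the kernel of a $\mathbf{W}^*$-morphism from $(G,u)$ to some object of $\mathbf{W}^*$. $YG=Y(G,u)$ is the set of ideals of $G$ maximal with respect to not containing $u$ (these are the proper maximal ideals), with the hull-kernel topology; it is compact Hausdorff. For $M\in YG$ there is a unique embedding $G/M\to\mathbb{R}$ of $\ell$-groups taking $u+M$ to $1$, and $g(M)$ denotes the image of $g+M$; this gives the (Yosida) embedding $G\le C(YG)$ with $u\mapsto 1$, whose image $0$-$1$ separates disjoint closed sets of $YG$.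 Then $\mathrm{coz}(g)=\{x\in YG: g(x)\ne0\}$, $Z(g)=YG\setminus\mathrm{coz}(g)$, and for closed $S\subseteq YG$, $I(S)=\{g\in G: Z(g)\supseteq S\}$. $G\in(\mathrm{Y})$ means: for all $g\in G$, $G(g)$ is an intersection of maximal ideals (the empty intersection being $G$). *)

theory Defs
  imports "HOL-Algebra.Coset" "HOL-Algebra.Lattice" "HOL-Analysis.Abstract_Topology"
begin

section \<open>Abelian lattice-ordered groups\<close>

text \<open>
  Groups follow the multiplicative notation of \<open>HOL-Algebra\<close>: the sum f + g is \<open>f \<otimes> g\<close>, 0 is
  \<open>\<one>\<close>, -f is \<open>inv f\<close> and the multiple nf is \<open>f [^] n\<close>.
\<close>

record 'a ogroup = "'a monoid" +
  ole :: "'a \<Rightarrow> 'a \<Rightarrow> bool" (infixl \<open>\<preceq>\<index>\<close> 50)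

definition ord_of :: "('a, 'm) ogroup_scheme \<Rightarrow> 'a gorder"
  where "ord_of G = \<lparr>carrier = carrier G, eq = (=), le = ole G\<rparr>"

locale abelian_lgroup = comm_group G for G (structure) +
  assumes is_lattice: "lattice (ord_of G)"
    and translate: "\<lbrakk>x \<in> carrier G; y \<in> carrier G; z \<in> carrier G; x \<preceq> y\<rbrakk> \<Longrightarrow> x \<otimes> z \<preceq> y \<otimes> z"

locale archimedean_lgroup = abelian_lgroup +
  assumes archimedean:
    "\<lbrakk>a \<in> carrier G; b \<in> carrier G; \<one> \<preceq> a; \<And>n::nat. a [^] n \<preceq> b\<rbrakk> \<Longrightarrow> a = \<one>"

definition labs :: "('a, 'm) ogroup_scheme \<Rightarrow> 'a \<Rightarrow> 'a"
  where "labs G f = f \<squnion>\<^bsub>ord_of G\<^esub> (inv\<^bsub>G\<^esub> f)"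

definition lhom :: "('a, 'm) ogroup_scheme \<Rightarrow> ('b, 'n) ogroup_scheme \<Rightarrow> ('a \<Rightarrow> 'b) set"
  where "lhom G H =
    {h \<in> hom G H. join_pres (ord_of G) (ord_of H) h \<and> meet_pres (ord_of G) (ord_of H) h}"

definition lideal :: "('a, 'm) ogroup_scheme \<Rightarrow> 'a set \<Rightarrow> bool"
  where "lideal G I \<longleftrightarrow> subgroup I G
    \<and> (\<forall>x\<in>I. \<forall>y\<in>I. x \<squnion>\<^bsub>ord_of G\<^esub> y \<in> I \<and> x \<sqinter>\<^bsub>ord_of G\<^esub> y \<in> I)
    \<and> (\<forall>x\<in>I. \<forall>y\<in>I. \<forall>z\<in>carrier G. x \<preceq>\<^bsub>G\<^esub> z \<and> z \<preceq>\<^bsub>G\<^esub> y \<longrightarrow> z \<in> I)"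

definition maximal_lideal :: "('a, 'm) ogroup_scheme \<Rightarrow> 'a set \<Rightarrow> bool"
  where "maximal_lideal G M \<longleftrightarrow> lideal G M \<and> M \<noteq> carrier G
    \<and> (\<forall>N. lideal G N \<and> N \<noteq> carrier G \<and> M \<subseteq> N \<longrightarrow> N = M)"

definition principal_lideal :: "('a, 'm) ogroup_scheme \<Rightarrow> 'a \<Rightarrow> 'a set"
  where "principal_lideal G g =
    {f \<in> carrier G. \<exists>n::nat. n > 0 \<and> labs G f \<preceq>\<^bsub>G\<^esub> labs G g [^]\<^bsub>G\<^esub> n}"

text \<open>The quotient G/K by an ideal K, with \<open>A \<le> B\<close> iff a \<open>\<le>\<close> b for some representatives.\<close>

definition lquotient :: "('a, 'm) ogroup_scheme \<Rightarrow> 'a set \<Rightarrow> 'a set ogroup"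
  where "lquotient G K =
    monoid.extend (G Mod K) (ogroup.fields (\<lambda>A B. \<exists>a\<in>A. \<exists>b\<in>B. a \<preceq>\<^bsub>G\<^esub> b))"


section \<open>The category W*\<close>

locale wstar = archimedean_lgroup +
  fixes u
  assumes unit_closed: "u \<in> carrier G"
    and unit_nonneg: "\<one> \<preceq> u"
    and strong_unit: "principal_lideal G u = carrier G"

definition wstar_hom ::
  "('a, 'm) ogroup_scheme \<Rightarrow> 'a \<Rightarrow> ('b, 'n) ogroup_scheme \<Rightarrow> 'b \<Rightarrow> ('a \<Rightarrow> 'b) set"
  where "wstar_hom G u H v = {h \<in> lhom G H. h u = v}"

text \<open>
  A type cannot be quantified existentially, so the codomain H is taken with elements of type
  \<^typ>\<open>'a set\<close>. Lemma \<open>wstar_kernelI\<close> below shows that this loses nothing: the kernel of a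
  morphism into an object of W* over any type is a kernel in this sense.
\<close>

definition wstar_kernel :: "('a, 'm) ogroup_scheme \<Rightarrow> 'a \<Rightarrow> 'a set \<Rightarrow> bool"
  where "wstar_kernel G u K \<longleftrightarrow>
    (\<exists>(H :: 'a set ogroup) v h. wstar H v \<and> h \<in> wstar_hom G u H v \<and> K = kernel G H h)"


section \<open>The Yosida representation\<close>

definition yosida_points :: "('a, 'm) ogroup_scheme \<Rightarrow> 'a \<Rightarrow> 'a set set"
  where "yosida_points G u = {M. lideal G M \<and> u \<notin> M
    \<and> (\<forall>N. lideal G N \<and> u \<notin> N \<and> M \<subseteq> N \<longrightarrow> N = M)}"

text \<open>
  The hull-kernel topology: its closed sets are the hulls \<open>{M. A \<subseteq> M}\<close>, which are intersections
  of hulls of single elements.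
\<close>

definition yosida_space :: "('a, 'm) ogroup_scheme \<Rightarrow> 'a \<Rightarrow> 'a set topology"
  where "yosida_space G u =
    topology_generated_by ((\<lambda>g. {M \<in> yosida_points G u. g \<notin> M}) ` carrier G)"

definition real_lgroup :: "real ogroup"
  where "real_lgroup = \<lparr>carrier = UNIV, mult = (+), one = 0, ole = (\<le>)\<rparr>"

text \<open>
  The unique embedding G/M \<open>\<rightarrow>\<close> \<open>\<real>\<close> sending u + M to 1; \<^const>\<open>extensional\<close> fixes its values
  outside the carrier, without which it would not be unique as a function on a type.
\<close>

definition yosida_embedding :: "('a, 'm) ogroup_scheme \<Rightarrow> 'a \<Rightarrow> 'a set \<Rightarrow> 'a set \<Rightarrow> real"
  where "yosida_embedding G u M =
    (THE e. e \<in> extensional (carrier (lquotient G M))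
      \<and> e \<in> lhom (lquotient G M) real_lgroup
      \<and> inj_on e (carrier (lquotient G M))
      \<and> e (M #>\<^bsub>G\<^esub> u) = 1)"

text \<open>The real number g(M).\<close>

definition yosida_val :: "('a, 'm) ogroup_scheme \<Rightarrow> 'a \<Rightarrow> 'a \<Rightarrow> 'a set \<Rightarrow> real"
  where "yosida_val G u g M = yosida_embedding G u M (M #>\<^bsub>G\<^esub> g)"

definition coz :: "('a, 'm) ogroup_scheme \<Rightarrow> 'a \<Rightarrow> 'a \<Rightarrow> 'a set set"
  where "coz G u g = {M \<in> topspace (yosida_space G u). yosida_val G u g M \<noteq> 0}"

definition zero_set :: "('a, 'm) ogroup_scheme \<Rightarrow> 'a \<Rightarrow> 'a \<Rightarrow> 'a set set"
  where "zero_set G u g = topspace (yosida_space G u) - coz G u g"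

definition vanishing_lideal :: "('a, 'm) ogroup_scheme \<Rightarrow> 'a \<Rightarrow> 'a set set \<Rightarrow> 'a set"
  where "vanishing_lideal G u S = {g \<in> carrier G. S \<subseteq> zero_set G u g}"


section \<open>The class (Y)\<close>

text \<open>Intersecting with \<^term>\<open>carrier G\<close> makes the empty intersection equal to G.\<close>

definition class_Y :: "('a, 'm) ogroup_scheme \<Rightarrow> bool"
  where "class_Y G \<longleftrightarrow> (\<forall>g\<in>carrier G.
    \<exists>\<M>. \<M> \<subseteq> {M. maximal_lideal G M} \<and> principal_lideal G g = carrier G \<inter> \<Inter>\<M>)"


section \<open>Consistency of the definitions\<close>

lemma ord_of_simps [simp]:
  "carrier (ord_of G) = carrier G" "eq (ord_of G) = (=)" "le (ord_of G) = ole G"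
  by (simp_all add: ord_of_def)

lemma lquotient_simps [simp]:
  "carrier (lquotient G K) = rcosets\<^bsub>G\<^esub> K"
  "mult (lquotient G K) = set_mult G"
  "one (lquotient G K) = K"
  "ole (lquotient G K) = (\<lambda>A B. \<exists>a\<in>A. \<exists>b\<in>B. a \<preceq>\<^bsub>G\<^esub> b)"
  by (simp_all add: lquotient_def FactGroup_def monoid.defs ogroup.defs)

lemma (in wstar) topspace_yosida_space [simp]:
  "topspace (yosida_space G u) = yosida_points G u"
  using unit_closed by (auto simp: yosida_space_def yosida_points_def)

text \<open>Transport of a sub-object of H along an injection.\<close>

lemma wstar_transport:
  fixes H (structure) and j :: "'b \<Rightarrow> 'c"
  assumes H: "wstar H v" and B: "subgroup B H" and vB: "v \<in> B"
    and jn: "\<And>x y. x \<in> B \<Longrightarrow> y \<in> B \<Longrightarrow> x \<squnion>\<^bsub>ord_of H\<^esub> y \<in> B"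
    and mt: "\<And>x y. x \<in> B \<Longrightarrow> y \<in> B \<Longrightarrow> x \<sqinter>\<^bsub>ord_of H\<^esub> y \<in> B"
    and j: "inj_on j B"
  shows "\<exists>K :: 'c ogroup. wstar K (j v) \<and> carrier K = j ` B \<and> one K = j \<one>
    \<and> (\<forall>x\<in>B. \<forall>y\<in>B. mult K (j x) (j y) = j (x \<otimes> y)
      \<and> j x \<squnion>\<^bsub>ord_of K\<^esub> j y = j (x \<squnion>\<^bsub>ord_of H\<^esub> y)
      \<and> j x \<sqinter>\<^bsub>ord_of K\<^esub> j y = j (x \<sqinter>\<^bsub>ord_of H\<^esub> y))"
proof -
  interpret wstar H v by (rule H)
  interpret B: subgroup B H by (rule B)
  interpret L: lattice "ord_of H" by (rule is_lattice)
  define k where "k = inv_into B j"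
  have kj [simp]: "k (j x) = x" if "x \<in> B" for x
    using j that by (simp add: k_def)
  have Bc [simp]: "x \<in> carrier H" if "x \<in> B" for x using that B.subset by auto
  define K :: "'c ogroup" where "K = \<lparr>carrier = j ` B, mult = (\<lambda>a b. j (k a \<otimes> k b)),
    one = j \<one>, ole = (\<lambda>a b. k a \<preceq> k b)\<rparr>"
  have K [simp]: "carrier K = j ` B" "mult K = (\<lambda>a b. j (k a \<otimes> k b))" "one K = j \<one>"
      "ole K = (\<lambda>a b. k a \<preceq> k b)"
    by (simp_all add: K_def)
  have cg: "comm_group K"
  proof (rule comm_groupI)
    fix x assume "x \<in> carrier K"
    then obtain b where b: "b \<in> B" "x = j b" by auto
    then show "\<exists>y\<in>carrier K. y \<otimes>\<^bsub>K\<^esub> x = \<one>\<^bsub>K\<^esub>"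
      by (intro bexI[of _ "j (inv b)"]) auto
  qed (auto simp: m_ac)
  interpret K: comm_group K by (rule cg)
  have antisym: "x = y" if "x \<preceq> y" "y \<preceq> x" "x \<in> B" "y \<in> B" for x y
    using L.le_antisym[of x y] that by simp
  have trans: "x \<preceq> z" if "x \<preceq> y" "y \<preceq> z" "x \<in> B" "y \<in> B" "z \<in> B" for x y z
    using L.le_trans[of x y z] that by simp
  have po: "partial_order (ord_of K)"
    by unfold_locales (use L.le_refl in \<open>auto dest: antisym intro: trans\<close>)
  have lub: "least (ord_of K) (j (x \<squnion>\<^bsub>ord_of H\<^esub> y)) (Upper (ord_of K) {j x, j y})"
    if "x \<in> B" "y \<in> B" for x y
    using that L.join_left[of x y] L.join_right[of x y] L.join_le[of x _ y]
    by (auto simp: least_def Upper_def jn)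
  have glb: "greatest (ord_of K) (j (x \<sqinter>\<^bsub>ord_of H\<^esub> y)) (Lower (ord_of K) {j x, j y})"
    if "x \<in> B" "y \<in> B" for x y
    using that L.meet_left[of x y] L.meet_right[of x y] L.meet_le[of _ x y]
    by (auto simp: greatest_def Lower_def mt)
  have lat: "lattice (ord_of K)"
  proof (intro lattice.intro upper_semilattice.intro lower_semilattice.intro po
      upper_semilattice_axioms.intro lower_semilattice_axioms.intro)
    fix x y assume "x \<in> carrier (ord_of K)" "y \<in> carrier (ord_of K)"
    then obtain a b where ab: "a \<in> B" "b \<in> B" and "x = j a" "y = j b" by auto
    then show "\<exists>s. least (ord_of K) s (Upper (ord_of K) {x, y})"
      and "\<exists>s. greatest (ord_of K) s (Lower (ord_of K) {x, y})"
      using lub[OF ab] glb[OF ab] by auto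
  qed
  interpret LK: lattice "ord_of K" by (rule lat)
  have join: "j x \<squnion>\<^bsub>ord_of K\<^esub> j y = j (x \<squnion>\<^bsub>ord_of H\<^esub> y)" if "x \<in> B" "y \<in> B" for x y
  proof -
    have "least (ord_of K) (j x \<squnion>\<^bsub>ord_of K\<^esub> j y) (Upper (ord_of K) {j x, j y})"
      unfolding join_def using that by (intro LK.sup_of_two_least) auto
    from LK.least_unique[OF this lub[OF that]] show ?thesis .
  qed
  have meet: "j x \<sqinter>\<^bsub>ord_of K\<^esub> j y = j (x \<sqinter>\<^bsub>ord_of H\<^esub> y)" if "x \<in> B" "y \<in> B" for x y
  proof -
    have "greatest (ord_of K) (j x \<sqinter>\<^bsub>ord_of K\<^esub> j y) (Lower (ord_of K) {j x, j y})"
      unfolding meet_def using that by (intro LK.inf_of_two_greatest) auto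
    from LK.greatest_unique[OF this glb[OF that]] show ?thesis .
  qed
  have inv: "inv\<^bsub>K\<^esub> (j x) = j (inv x)" if "x \<in> B" for x
    using that by (intro K.inv_equality) auto
  have powB: "x [^] (n::nat) \<in> B" if "x \<in> B" for x n
    using that by (induction n) auto
  have pow: "j x [^]\<^bsub>K\<^esub> (n::nat) = j (x [^] n)" if "x \<in> B" for x n
    using that by (induction n) (auto simp: powB)
  have abs: "labs K (j x) = j (labs H x)" and absB: "labs H x \<in> B" if "x \<in> B" for x
    using that by (auto simp: labs_def inv join jn)
  have "wstar K (j v)"
  proof (intro wstar.intro archimedean_lgroup.intro abelian_lgroup.intro cg lat
      wstar_axioms.intro archimedean_lgroup_axioms.intro abelian_lgroup_axioms.intro)
    show "x \<otimes>\<^bsub>K\<^esub> z \<preceq>\<^bsub>K\<^esub> y \<otimes>\<^bsub>K\<^esub> z"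
      if "x \<in> carrier K" "y \<in> carrier K" "z \<in> carrier K" "x \<preceq>\<^bsub>K\<^esub> y" for x y z
      using that by (auto simp: translate)
    show "a = \<one>\<^bsub>K\<^esub>"
      if ab: "a \<in> carrier K" "b \<in> carrier K" "\<one>\<^bsub>K\<^esub> \<preceq>\<^bsub>K\<^esub> a" "\<And>n::nat. a [^]\<^bsub>K\<^esub> n \<preceq>\<^bsub>K\<^esub> b" for a b
    proof -
      obtain x y where xy: "x \<in> B" "a = j x" "y \<in> B" "b = j y" using ab(1,2) by auto
      have "x [^] n \<preceq> y" for n :: nat using ab(4)[of n] xy by (simp add: pow powB)
      then have "x = \<one>" using archimedean[of x y] ab(3) xy by simp
      then show ?thesis using xy by simp
    qed
    show "j v \<in> carrier K" using vB by simp
    show "\<one>\<^bsub>K\<^esub> \<preceq>\<^bsub>K\<^esub> j v" using vB unit_nonneg by simp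
    show "principal_lideal K (j v) = carrier K"
    proof (intro equalityI subsetI)
      fix a assume "a \<in> carrier K"
      then obtain x where x: "x \<in> B" "a = j x" by auto
      then have "x \<in> principal_lideal H v" by (simp add: strong_unit)
      then obtain n :: nat where "n > 0" "labs H x \<preceq> labs H v [^] n"
        by (auto simp: principal_lideal_def)
      then show "a \<in> principal_lideal K (j v)"
        using x vB by (auto simp: principal_lideal_def abs absB pow powB intro!: exI[of _ n])
    qed (auto simp: principal_lideal_def)
  qed
  then show ?thesis
    using join meet by (intro exI[of _ K]) auto
qed

lemma wstar_kernelI:
  fixes G :: "('a, 'm) ogroup_scheme" and H :: "('b, 'n) ogroup_scheme"
  assumes G: "wstar G u" and H: "wstar H v" and h: "h \<in> wstar_hom G u H v"
  shows "wstar_kernel G u (kernel G H h)"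
proof -
  interpret G: wstar G u by (rule G)
  interpret H: wstar H v by (rule H)
  interpret LG: lattice "ord_of G" by (rule G.is_lattice)
  have hom: "h \<in> hom G H" and hu: "h u = v"
    and hj: "\<And>x y. x \<in> carrier G \<Longrightarrow> y \<in> carrier G \<Longrightarrow>
      h (x \<squnion>\<^bsub>ord_of G\<^esub> y) = h x \<squnion>\<^bsub>ord_of H\<^esub> h y"
    and hm: "\<And>x y. x \<in> carrier G \<Longrightarrow> y \<in> carrier G \<Longrightarrow>
      h (x \<sqinter>\<^bsub>ord_of G\<^esub> y) = h x \<sqinter>\<^bsub>ord_of H\<^esub> h y"
    using h by (auto simp: wstar_hom_def lhom_def join_pres_def meet_pres_def)
  interpret h: group_hom G H h
    using hom by unfold_locales
  define B where "B = h ` carrier G"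
  define j where "j y = {x \<in> carrier G. h x = y}" for y
  have hB: "h x \<in> B" if "x \<in> carrier G" for x using that by (simp add: B_def)
  have "j y \<noteq> {}" if "y \<in> B" for y using that by (auto simp: B_def j_def)
  then have j: "inj_on j B" by (force simp: inj_on_def j_def)
  have sub: "subgroup B H" unfolding B_def by (rule h.img_is_subgroup)
  have vB: "v \<in> B" using G.unit_closed hu by (auto simp: B_def)
  have jn: "x \<squnion>\<^bsub>ord_of H\<^esub> y \<in> B" if "x \<in> B" "y \<in> B" for x y
    using that by (auto simp: B_def simp flip: hj intro!: imageI LG.join_closed[simplified])
  have mt: "x \<sqinter>\<^bsub>ord_of H\<^esub> y \<in> B" if "x \<in> B" "y \<in> B" for x y
    using that by (auto simp: B_def simp flip: hm intro!: imageI LG.meet_closed[simplified])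
  obtain K :: "'a set ogroup" where K: "wstar K (j v)" "carrier K = j ` B" "one K = j (one H)"
    and op: "\<And>x y. x \<in> B \<Longrightarrow> y \<in> B \<Longrightarrow> mult K (j x) (j y) = j (x \<otimes>\<^bsub>H\<^esub> y)"
      "\<And>x y. x \<in> B \<Longrightarrow> y \<in> B \<Longrightarrow> j x \<squnion>\<^bsub>ord_of K\<^esub> j y = j (x \<squnion>\<^bsub>ord_of H\<^esub> y)"
      "\<And>x y. x \<in> B \<Longrightarrow> y \<in> B \<Longrightarrow> j x \<sqinter>\<^bsub>ord_of K\<^esub> j y = j (x \<sqinter>\<^bsub>ord_of H\<^esub> y)"
    using wstar_transport[OF H sub vB jn mt j] by auto
  interpret K: wstar K "j v" by (rule K)
  have "j \<circ> h \<in> wstar_hom G u K (j v)"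
    using G.is_lattice K.is_lattice
    by (auto simp: wstar_hom_def lhom_def hom_def join_pres_def meet_pres_def K(2) op hB hj hm hu)
  moreover have "kernel G K (j \<circ> h) = kernel G H h"
    using inj_onD[OF j _ hB subgroup.one_closed[OF sub]] by (auto simp: kernel_def K(3))
  ultimately show ?thesis
    using K(1) unfolding wstar_kernel_def by metis
qed

end

(*
  For a maximal ideal M the ordered group G/M is totally ordered without infinitesimals, so by
  Hoelder's theorem it embeds uniquely into the reals with u + M going to 1. Hence g(M) = 0 iff
  g lies in M, and the conditions on zero sets, cozero sets and maximal ideals all say that G(g) is
  the intersection of the maximal ideals containing g. Intersections of maximal ideals have
  Archimedean quotients because the quotient embeds into a power of the reals. Conversely, if G/K is
  Archimedean and f is outside K, some n|f| is not below u modulo K, and then the ideal generated by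
  K and the positive part of u - n|f| omits u. A maximal ideal above it cannot contain f, as
  otherwise it would contain u. Finally, G/G(g) is itself an object of W* when it is Archimedean.
*)
theory Submission
  imports Defs
begin

section \<open>Order and ideals in abelian l-groups\<close>

text \<open>Comments are in additive notation: x + y is \<open>x \<otimes> y\<close>, 0 is
  \<open>\<one>\<close>, n x is \<open>x [^] n\<close>. The value g(M) is a definite description, so
  its zeros are inaccessible until Hoelder's theorem gives both existence and uniqueness of the
  embedding of G/M. That G/M is a chain rests on one fact: the positive and negative parts of an
  element are disjoint. If neither part of x lay in M, maximality would put u below a multiple of
  each, up to an error in M, and disjointness of these multiples would force u into M. The same
  disjointness keeps u out of the ideal built from an Archimedean quotient. All equivalences are
  obtained for one fixed g; only at the end are they collected under the quantifier.\<close>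

context abelian_lgroup
begin

sublocale ord: lattice "ord_of G"
  by (rule is_lattice)

abbreviation jn :: "'a \<Rightarrow> 'a \<Rightarrow> 'a" where "jn x y \<equiv> x \<squnion>\<^bsub>ord_of G\<^esub> y"
abbreviation mt :: "'a \<Rightarrow> 'a \<Rightarrow> 'a" where "mt x y \<equiv> x \<sqinter>\<^bsub>ord_of G\<^esub> y"

section \<open>Order, lattice operations and absolute value\<close>

lemma le_refl [simp]: "x \<in> carrier G \<Longrightarrow> x \<preceq> x"
  using ord.le_refl by simp

lemma le_antisym: "\<lbrakk>x \<preceq> y; y \<preceq> x; x \<in> carrier G; y \<in> carrier G\<rbrakk> \<Longrightarrow> x = y"
  using ord.le_antisym[of x y] by simp

lemma le_trans:
  "\<lbrakk>x \<preceq> y; y \<preceq> z; x \<in> carrier G; y \<in> carrier G; z \<in> carrier G\<rbrakk> \<Longrightarrow> x \<preceq> z"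
  using ord.le_trans[of x y z] by simp

lemma jn_closed [simp]: "\<lbrakk>x \<in> carrier G; y \<in> carrier G\<rbrakk> \<Longrightarrow> jn x y \<in> carrier G"
  using ord.join_closed[of x y] by simp

lemma mt_closed [simp]: "\<lbrakk>x \<in> carrier G; y \<in> carrier G\<rbrakk> \<Longrightarrow> mt x y \<in> carrier G"
  using ord.meet_closed[of x y] by simp

lemma jn_ub1: "\<lbrakk>x \<in> carrier G; y \<in> carrier G\<rbrakk> \<Longrightarrow> x \<preceq> jn x y"
  using ord.join_left[of x y] by simp

lemma jn_ub2: "\<lbrakk>x \<in> carrier G; y \<in> carrier G\<rbrakk> \<Longrightarrow> y \<preceq> jn x y"
  using ord.join_right[of x y] by simp

lemma jn_least:
  "\<lbrakk>x \<preceq> z; y \<preceq> z; x \<in> carrier G; y \<in> carrier G; z \<in> carrier G\<rbrakk> \<Longrightarrow> jn x y \<preceq> z"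
  using ord.join_le[of x z y] by simp

lemma mt_lb1: "\<lbrakk>x \<in> carrier G; y \<in> carrier G\<rbrakk> \<Longrightarrow> mt x y \<preceq> x"
  using ord.meet_left[of x y] by simp

lemma mt_lb2: "\<lbrakk>x \<in> carrier G; y \<in> carrier G\<rbrakk> \<Longrightarrow> mt x y \<preceq> y"
  using ord.meet_right[of x y] by simp

lemma mt_greatest:
  "\<lbrakk>z \<preceq> x; z \<preceq> y; x \<in> carrier G; y \<in> carrier G; z \<in> carrier G\<rbrakk> \<Longrightarrow> z \<preceq> mt x y"
  using ord.meet_le[of z x y] by simp

lemma mult_mono:
  assumes "x \<preceq> y" "z \<preceq> w" "x \<in> carrier G" "y \<in> carrier G" "z \<in> carrier G" "w \<in> carrier G"
  shows "x \<otimes> z \<preceq> y \<otimes> w"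
proof -
  have "x \<otimes> z \<preceq> y \<otimes> z" using assms by (simp add: translate)
  moreover have "y \<otimes> z \<preceq> y \<otimes> w" using assms translate[of z w y] by (simp add: m_comm)
  ultimately show ?thesis using assms by (auto intro: le_trans)
qed

lemma le_shift_right:
  assumes "x \<in> carrier G" "y \<in> carrier G" "z \<in> carrier G"
  shows "x \<otimes> z \<preceq> y \<longleftrightarrow> x \<preceq> y \<otimes> inv z"
proof
  show "x \<preceq> y \<otimes> inv z" if "x \<otimes> z \<preceq> y"
    using translate[of "x \<otimes> z" y "inv z"] that assms by (simp add: m_assoc)
  show "x \<otimes> z \<preceq> y" if "x \<preceq> y \<otimes> inv z"
    using translate[of x "y \<otimes> inv z" z] that assms by (simp add: m_assoc)
qed

lemma inv_shift_right:
  assumes "x \<in> carrier G" "y \<in> carrier G" "z \<in> carrier G"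
  shows "x \<otimes> inv z \<preceq> y \<longleftrightarrow> x \<preceq> y \<otimes> z"
  using le_shift_right[of x y "inv z"] assms by simp

lemma inv_antimono:
  assumes "x \<preceq> y" "x \<in> carrier G" "y \<in> carrier G"
  shows "inv y \<preceq> inv x"
proof -
  \<comment> \<open>Adding -x - y to both sides of x <= y gives -y <= -x.\<close>
  have "x \<otimes> (inv x \<otimes> inv y) = inv y" "y \<otimes> (inv x \<otimes> inv y) = inv x"
    using assms m_lcomm[of y "inv x" "inv y"] by (simp_all add: m_assoc[symmetric])
  then show ?thesis using translate[of x y "inv x \<otimes> inv y"] assms by simp
qed

lemma one_le_mult:
  "\<lbrakk>\<one> \<preceq> x; \<one> \<preceq> y; x \<in> carrier G; y \<in> carrier G\<rbrakk> \<Longrightarrow> \<one> \<preceq> x \<otimes> y"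
  using mult_mono[of \<one> x \<one> y] by simp

lemma le_mult_one_le:
  "\<lbrakk>x \<preceq> y; \<one> \<preceq> z; x \<in> carrier G; y \<in> carrier G; z \<in> carrier G\<rbrakk> \<Longrightarrow> x \<preceq> y \<otimes> z"
  using mult_mono[of x y \<one> z] by simp

lemma one_le_pow: "\<lbrakk>\<one> \<preceq> x; x \<in> carrier G\<rbrakk> \<Longrightarrow> \<one> \<preceq> x [^] (n::nat)"
  by (induction n) (auto intro: one_le_mult)

lemma pow_mono: "\<lbrakk>x \<preceq> y; x \<in> carrier G; y \<in> carrier G\<rbrakk> \<Longrightarrow> x [^] (n::nat) \<preceq> y [^] n"
  by (induction n) (auto intro: mult_mono)

lemma labs_closed [simp]: "x \<in> carrier G \<Longrightarrow> labs G x \<in> carrier G"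
  by (simp add: labs_def)

lemma labs_le_iff:
  assumes "x \<in> carrier G" "y \<in> carrier G"
  shows "labs G x \<preceq> y \<longleftrightarrow> x \<preceq> y \<and> inv x \<preceq> y"
  unfolding labs_def
  by (meson assms inv_closed jn_closed jn_least jn_ub1 jn_ub2 le_trans)

lemma le_labs: "x \<in> carrier G \<Longrightarrow> x \<preceq> labs G x"
  and inv_le_labs: "x \<in> carrier G \<Longrightarrow> inv x \<preceq> labs G x"
  by (simp_all add: labs_def jn_ub1 jn_ub2)

text \<open>
  Additively, \<open>y = x \<and> 0\<close> satisfies \<open>y \<le> y + y\<close> whenever \<open>0 \<le> x + x\<close>: both \<open>y \<le> x + x\<close> and
  \<open>y \<le> x\<close> hold, so \<open>y \<le> x + y\<close>.
\<close>

lemma one_le_if_one_le_square: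
  assumes x: "x \<in> carrier G" and "\<one> \<preceq> x \<otimes> x"
  shows "\<one> \<preceq> x"
proof -
  define y where "y = mt x \<one>"
  have y: "y \<in> carrier G" "y \<preceq> x" "y \<preceq> \<one>"
    using x by (simp_all add: y_def mt_lb1 mt_lb2)
  have meet_le: "a \<preceq> b \<otimes> y" if "a \<preceq> b \<otimes> x" "a \<preceq> b" "a \<in> carrier G" "b \<in> carrier G" for a b
  proof -
    have "inv b \<otimes> a \<preceq> x" "inv b \<otimes> a \<preceq> \<one>"
      using mult_mono[OF le_refl that(1), of "inv b"] mult_mono[OF le_refl that(2), of "inv b"]
        that(3,4) x by (simp_all add: m_assoc[symmetric])
    then have "inv b \<otimes> a \<preceq> y"
      unfolding y_def using that x by (intro mt_greatest) auto
    from mult_mono[OF le_refl this, of b] show ?thesis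
      using that y by (simp add: m_assoc[symmetric])
  qed
  have "y \<preceq> x \<otimes> x" using assms y le_trans[of y \<one> "x \<otimes> x"] by simp
  then have "y \<preceq> x \<otimes> y" using y x by (intro meet_le) auto
  then have "y \<preceq> y \<otimes> y" using y x by (intro meet_le) (auto simp: m_comm)
  then have "\<one> \<preceq> y"
    using le_shift_right[of \<one> "y \<otimes> y" y] y by (simp add: m_assoc)
  then show ?thesis using y x le_trans by blast
qed

lemma one_le_labs: "x \<in> carrier G \<Longrightarrow> \<one> \<preceq> labs G x"
  using mult_mono[OF le_labs inv_le_labs, of x x] one_le_if_one_le_square[of "labs G x"] by simp

lemma labs_of_one_le:
  assumes "x \<in> carrier G" "\<one> \<preceq> x"
  shows "labs G x = x"
proof (rule le_antisym)
  show "labs G x \<preceq> x"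
    using assms inv_antimono[of \<one> x] le_trans[of "inv x" \<one> x] by (simp add: labs_le_iff)
qed (use assms in \<open>auto simp: le_labs\<close>)

section \<open>Ideals generated by sets of positive elements\<close>

definition bounded_by :: "'a set \<Rightarrow> 'a set"
  where "bounded_by C = {f \<in> carrier G. \<exists>c\<in>C. f \<preceq> c \<and> inv f \<preceq> c}"

text \<open>Positivity makes the sum of two bounds a common bound, and with a common bound every
  closure property is a short inequality. For such \<open>C\<close> the set is the ideal generated
  by \<open>C\<close>; principal ideals and extensions by one element are both of this kind.\<close>

lemma lideal_bounded_by:
  assumes C: "C \<subseteq> carrier G" "C \<noteq> {}" "\<And>c. c \<in> C \<Longrightarrow> \<one> \<preceq> c"
    and mult: "\<And>c d. c \<in> C \<Longrightarrow> d \<in> C \<Longrightarrow> c \<otimes> d \<in> C"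
  shows "lideal G (bounded_by C)"
proof -
  have common: "\<exists>c\<in>C. x \<preceq> c \<and> inv x \<preceq> c \<and> y \<preceq> c \<and> inv y \<preceq> c"
    if xy: "x \<in> bounded_by C" "y \<in> bounded_by C" for x y
  proof -
    obtain c d where cd: "c \<in> C" "x \<preceq> c" "inv x \<preceq> c" "d \<in> C" "y \<preceq> d" "inv y \<preceq> d"
      using xy by (auto simp: bounded_by_def)
    moreover have "x \<in> carrier G" "y \<in> carrier G" "c \<in> carrier G" "d \<in> carrier G"
      using xy C cd by (auto simp: bounded_by_def)
    ultimately show ?thesis
      using C le_mult_one_le[of x c d] le_mult_one_le[of "inv x" c d]
        le_mult_one_le[of y d c] le_mult_one_le[of "inv y" d c]
      by (intro bexI[of _ "c \<otimes> d"]) (auto simp: mult m_comm[of d c])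
  qed
  have sub: "bounded_by C \<subseteq> carrier G" by (auto simp: bounded_by_def)
  have memI: "z \<in> bounded_by C" if "z \<in> carrier G" "c \<in> C" "z \<preceq> c" "inv z \<preceq> c" for z c
    using that by (auto simp: bounded_by_def)
  have between: "z \<in> bounded_by C"
    if xy: "x \<in> bounded_by C" "y \<in> bounded_by C" and z: "z \<in> carrier G" "x \<preceq> z" "z \<preceq> y" for x y z
  proof -
    obtain c where c: "c \<in> C" "inv x \<preceq> c" "y \<preceq> c" using common[OF xy] by blast
    have carr: "x \<in> carrier G" "y \<in> carrier G" "c \<in> carrier G" using xy sub C c by auto
    have "inv z \<preceq> inv x" using z carr by (intro inv_antimono) auto
    then have "inv z \<preceq> c" "z \<preceq> c"
      using c z carr le_trans[of "inv z" "inv x" c] le_trans[of z y c] by auto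
    then show ?thesis using memI c z by blast
  qed
  have inv: "inv x \<in> bounded_by C" if "x \<in> bounded_by C" for x
    using that by (auto simp: bounded_by_def)
  have mul: "x \<otimes> y \<in> bounded_by C" if xy: "x \<in> bounded_by C" "y \<in> bounded_by C" for x y
  proof -
    obtain c where c: "c \<in> C" "x \<preceq> c" "inv x \<preceq> c" "y \<preceq> c" "inv y \<preceq> c"
      using common[OF xy] by blast
    have "x \<in> carrier G" "y \<in> carrier G" "c \<in> carrier G" using xy sub C c by auto
    then show ?thesis
      using c mult[of c c] by (intro memI[of _ "c \<otimes> c"]) (auto simp: inv_mult intro: mult_mono)
  qed
  have up: "c \<in> bounded_by C" if "c \<in> C" for c
  proof (rule memI[OF _ that])
    have "c \<in> carrier G" "\<one> \<preceq> c" using that C by auto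
    then show "c \<in> carrier G" "c \<preceq> c" "inv c \<preceq> c"
      using inv_antimono[of \<one> c] le_trans[of "inv c" \<one> c] by auto
  qed
  have jm: "jn x y \<in> bounded_by C \<and> mt x y \<in> bounded_by C"
    if xy: "x \<in> bounded_by C" "y \<in> bounded_by C" for x y
  proof -
    obtain c where c: "c \<in> C" "x \<preceq> c" "inv x \<preceq> c" "y \<preceq> c" "inv y \<preceq> c"
      using common[OF xy] by blast
    have carr: "x \<in> carrier G" "y \<in> carrier G" "c \<in> carrier G" using xy sub C c by auto
    have "inv c \<preceq> x" "inv c \<preceq> y"
      using inv_antimono[of "inv x" c] inv_antimono[of "inv y" c] c carr by auto
    \<comment> \<open>Convexity does the rest: the join lies between x and c, the meet between -c
      and x.\<close>
    then have "x \<preceq> jn x y" "jn x y \<preceq> c" "inv c \<preceq> mt x y" "mt x y \<preceq> x"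
      using c carr by (auto intro: jn_ub1 jn_least mt_lb1 mt_greatest)
    then show ?thesis
      using between[OF xy(1) up[OF c(1)]] between[OF inv[OF up[OF c(1)]] xy(1)] carr by simp
  qed
  have "subgroup (bounded_by C) G"
  proof (rule subgroupI)
    obtain c where "c \<in> C" using C by auto
    then show "bounded_by C \<noteq> {}" using up by blast
  qed (fact sub inv mul)+
  then show ?thesis
    unfolding lideal_def using jm between by (intro conjI ballI impI) (assumption | blast)+
qed

lemma mem_principal_lideal_iff:
  "f \<in> principal_lideal G g \<longleftrightarrow> f \<in> carrier G \<and>
    (\<exists>n::nat. n > 0 \<and> f \<preceq> labs G g [^] n \<and> inv f \<preceq> labs G g [^] n)" if "g \<in> carrier G"
  using that by (auto simp: principal_lideal_def labs_le_iff)

lemma lideal_principal_lideal: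
  assumes g: "g \<in> carrier G"
  shows "lideal G (principal_lideal G g)"
proof -
  define C where "C = (\<lambda>n::nat. labs G g [^] n) ` {0<..}"
  have "lideal G (bounded_by C)"
  proof (rule lideal_bounded_by)
    show "c \<otimes> d \<in> C" if cd: "c \<in> C" "d \<in> C" for c d
    proof -
      obtain n k :: nat where nk: "c = labs G g [^] n" "n > 0" "d = labs G g [^] k"
        using cd by (auto simp: C_def)
      then have "c \<otimes> d = labs G g [^] (n + k)" using g by (simp add: nat_pow_mult)
      then show ?thesis using nk by (auto simp: C_def)
    qed
  qed (use g one_le_labs in \<open>auto simp: C_def intro: one_le_pow\<close>)
  moreover have "bounded_by C = principal_lideal G g"
    using g by (auto simp: mem_principal_lideal_iff bounded_by_def C_def)
  ultimately show ?thesis by simp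
qed

lemma mem_own_principal_lideal: "g \<in> carrier G \<Longrightarrow> g \<in> principal_lideal G g"
  by (auto simp: mem_principal_lideal_iff le_labs inv_le_labs intro!: exI[of _ 1])

section \<open>Closure properties of ideals\<close>

lemma lideal_subgroup: "lideal G I \<Longrightarrow> subgroup I G"
  unfolding lideal_def by blast

lemma lideal_carrier: "\<lbrakk>lideal G I; x \<in> I\<rbrakk> \<Longrightarrow> x \<in> carrier G"
  using lideal_subgroup subgroup.mem_carrier by metis

lemma lideal_one: "lideal G I \<Longrightarrow> \<one> \<in> I"
  using lideal_subgroup subgroup.one_closed by metis

lemma lideal_inv: "\<lbrakk>lideal G I; x \<in> I\<rbrakk> \<Longrightarrow> inv x \<in> I"
  using lideal_subgroup subgroup.m_inv_closed by metis

lemma lideal_mult: "\<lbrakk>lideal G I; x \<in> I; y \<in> I\<rbrakk> \<Longrightarrow> x \<otimes> y \<in> I"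
  using lideal_subgroup subgroup.m_closed by metis

lemma lideal_pow: "\<lbrakk>lideal G I; x \<in> I\<rbrakk> \<Longrightarrow> x [^] (n::nat) \<in> I"
  by (induction n) (auto intro: lideal_one lideal_mult)

lemma lideal_jn: "\<lbrakk>lideal G I; x \<in> I; y \<in> I\<rbrakk> \<Longrightarrow> jn x y \<in> I"
  and lideal_mt: "\<lbrakk>lideal G I; x \<in> I; y \<in> I\<rbrakk> \<Longrightarrow> mt x y \<in> I"
  unfolding lideal_def by blast+

lemma lideal_convex:
  "\<lbrakk>lideal G I; x \<preceq> z; z \<preceq> y; x \<in> I; y \<in> I; z \<in> carrier G\<rbrakk> \<Longrightarrow> z \<in> I"
  unfolding lideal_def by blast

lemma lideal_labs: "\<lbrakk>lideal G I; x \<in> I\<rbrakk> \<Longrightarrow> labs G x \<in> I"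
  by (simp add: labs_def lideal_jn lideal_inv)

lemma lideal_boundedI:
  assumes "lideal G I" "x \<preceq> y" "inv x \<preceq> y" "x \<in> carrier G" "y \<in> I"
  shows "x \<in> I"
proof (rule lideal_convex)
  show "inv y \<preceq> x" using inv_antimono[of "inv x" y] assms lideal_carrier by auto
qed (use assms lideal_inv in auto)

lemma lideal_labsD: "\<lbrakk>lideal G I; labs G x \<in> I; x \<in> carrier G\<rbrakk> \<Longrightarrow> x \<in> I"
  by (erule lideal_boundedI[where y = "labs G x"]) (auto simp: le_labs inv_le_labs)

lemma principal_lideal_least:
  assumes I: "lideal G I" "g \<in> I"
  shows "principal_lideal G g \<subseteq> I"
proof
  fix f assume "f \<in> principal_lideal G g"
  then obtain n :: nat where "f \<in> carrier G" "f \<preceq> labs G g [^] n" "inv f \<preceq> labs G g [^] n"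
    using mem_principal_lideal_iff[of g f] lideal_carrier[OF I] by auto
  then show "f \<in> I" using lideal_boundedI I lideal_pow lideal_labs by meson
qed

text \<open>For positive x and y this is orthogonality: their meet is 0. The test element
  \<open>z\<close> may have any sign, which allows differences such as u - c to be inserted
  directly.\<close>

definition disj :: "'a \<Rightarrow> 'a \<Rightarrow> bool"
  where "disj x y \<longleftrightarrow> (\<forall>z\<in>carrier G. z \<preceq> x \<and> z \<preceq> y \<longrightarrow> z \<preceq> \<one>)"

lemma disj_sym: "disj x y \<Longrightarrow> disj y x"
  by (auto simp: disj_def)

text \<open>In additive notation, if \<open>z \<le> x\<close> and \<open>z \<le> y + w\<close> then \<open>z - w\<close> is below x and y.\<close>

lemma disj_mult:
  assumes "disj x y" "disj x w" "\<one> \<preceq> w" "x \<in> carrier G" "y \<in> carrier G" "w \<in> carrier G"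
  shows "disj x (y \<otimes> w)"
  unfolding disj_def
proof (intro ballI impI)
  fix z assume z: "z \<in> carrier G" "z \<preceq> x \<and> z \<preceq> y \<otimes> w"
  have "z \<otimes> inv w \<preceq> y" using z assms by (simp add: inv_shift_right)
  moreover have "z \<otimes> inv w \<preceq> x"
    using z assms le_mult_one_le[of z x w] by (simp add: inv_shift_right)
  ultimately have "z \<otimes> inv w \<preceq> \<one>" using assms z by (simp add: disj_def)
  then have "z \<preceq> w" using z assms by (simp add: inv_shift_right)
  then show "z \<preceq> \<one>" using z assms by (simp add: disj_def)
qed

lemma disj_pow:
  assumes "disj x y" "\<one> \<preceq> y" "x \<in> carrier G" "y \<in> carrier G"
  shows "disj x (y [^] (n::nat))"
proof (induction n)
  case 0 then show ?case by (simp add: disj_def)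
next
  case (Suc n) then show ?case using assms by (auto intro: disj_mult)
qed

text \<open>Let q be the negative part of x. The positive part is at most q + x, so a common lower
  bound z satisfies z <= q + x and z <= q. Hence q - z is above both -x and 0, that is q <= q - z,
  and z <= 0.\<close>

lemma disj_pos_neg:
  assumes x: "x \<in> carrier G"
  shows "disj (jn x \<one>) (jn (inv x) \<one>)"
  unfolding disj_def
proof (intro ballI impI)
  define q where "q = jn (inv x) \<one>"
  have q: "q \<in> carrier G" "inv x \<preceq> q" "\<one> \<preceq> q" using x by (auto simp: q_def jn_ub1 jn_ub2)
  fix z assume z: "z \<in> carrier G" "z \<preceq> jn x \<one> \<and> z \<preceq> jn (inv x) \<one>"
  have "x \<preceq> q \<otimes> x" using le_mult_one_le[of x x q] q x by (simp add: m_comm)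
  moreover have "\<one> \<preceq> q \<otimes> x" using translate[of "inv x" q x] q x by simp
  ultimately have "jn x \<one> \<preceq> q \<otimes> x" using x q by (intro jn_least) auto
  then have "z \<preceq> q \<otimes> x" using z x q le_trans[of z "jn x \<one>" "q \<otimes> x"] by auto
  then have "z \<otimes> (inv x \<otimes> inv z) \<preceq> q \<otimes> x \<otimes> (inv x \<otimes> inv z)"
    using x q z by (intro translate) auto
  moreover have "z \<otimes> (inv x \<otimes> inv z) = inv x"
    using x z m_lcomm[of z "inv x" "inv z"] by simp
  moreover have "q \<otimes> x \<otimes> (inv x \<otimes> inv z) = q \<otimes> inv z"
    using x q z inv_solve_left[of "inv z" x "inv x \<otimes> inv z"] by (simp add: m_assoc[of q] m_assoc[of x, symmetric])
  ultimately have "inv x \<preceq> q \<otimes> inv z" by simp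
  moreover have "\<one> \<preceq> q \<otimes> inv z"
    using le_shift_right[of \<one> q z] z by (simp add: q q_def[symmetric])
  ultimately have "q \<preceq> q \<otimes> inv z"
    using x q z by (subst (1) q_def) (intro jn_least, auto)
  then have "q \<otimes> z \<preceq> q" using q z by (simp add: le_shift_right)
  then show "z \<preceq> \<one>"
    using le_shift_right[of z q q] q z by (simp add: m_comm)
qed

text \<open>For an ideal M and positive p this is the ideal generated by both. The summands from M
  are restricted to positive ones so that all bounds n p + m are positive.\<close>

definition adjoin :: "'a set \<Rightarrow> 'a \<Rightarrow> 'a set"
  where "adjoin M p = bounded_by {p [^] (n::nat) \<otimes> m | n m. m \<in> M \<and> \<one> \<preceq> m}"

lemma lideal_adjoin:
  assumes M: "lideal G M" and p: "p \<in> carrier G" "\<one> \<preceq> p"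
  shows "lideal G (adjoin M p)" "M \<subseteq> adjoin M p" "p \<in> adjoin M p"
proof -
  let ?C = "{p [^] (n::nat) \<otimes> m | n m. m \<in> M \<and> \<one> \<preceq> m}"
  note carr = lideal_carrier[OF M]
  show "lideal G (adjoin M p)"
    unfolding adjoin_def
  proof (rule lideal_bounded_by)
    show "?C \<subseteq> carrier G" using p carr by auto
    show "?C \<noteq> {}" using lideal_one[OF M] by force
    show "\<one> \<preceq> c" if "c \<in> ?C" for c using that p carr by (auto intro: one_le_mult one_le_pow)
    show "c \<otimes> d \<in> ?C" if cd: "c \<in> ?C" "d \<in> ?C" for c d
    proof -
      obtain n k :: nat and a b where "c = p [^] n \<otimes> a" "d = p [^] k \<otimes> b"
        and ab: "a \<in> M" "\<one> \<preceq> a" "b \<in> M" "\<one> \<preceq> b"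
        using cd by auto
      then have "c \<otimes> d = p [^] (n + k) \<otimes> (a \<otimes> b)"
        using p carr by (simp add: nat_pow_mult[symmetric] m_ac)
      then show ?thesis using lideal_mult[OF M] one_le_mult carr ab by blast
    qed
  qed
  have memI: "f \<in> adjoin M p"
    if "f \<in> carrier G" "m \<in> M" "\<one> \<preceq> m" "f \<preceq> p [^] n \<otimes> m" "inv f \<preceq> p [^] n \<otimes> m"
    for f m and n :: nat
    using that unfolding adjoin_def bounded_by_def by blast
  show "M \<subseteq> adjoin M p"
  proof
    fix f assume f: "f \<in> M"
    \<comment> \<open>Zero copies of p are enough: |f| itself is a positive element of M.\<close>
    show "f \<in> adjoin M p"
      by (rule memI[of f "labs G f" 0])
        (use f carr lideal_labs[OF M] in \<open>auto simp: one_le_labs le_labs inv_le_labs\<close>)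
  qed
  have "inv p \<preceq> p" using p inv_antimono[of \<one> p] le_trans[of "inv p" \<one> p] by auto
  then show "p \<in> adjoin M p"
    by (intro memI[of p \<one> 1]) (use p lideal_one[OF M] in auto)
qed

end

section \<open>Quotients by ideals\<close>

lemma (in lattice) join_eqI:
  assumes "x \<in> carrier L" "y \<in> carrier L" "s \<in> carrier L" "x \<sqsubseteq> s" "y \<sqsubseteq> s"
    and "\<And>z. z \<in> carrier L \<Longrightarrow> x \<sqsubseteq> z \<Longrightarrow> y \<sqsubseteq> z \<Longrightarrow> s \<sqsubseteq> z"
  shows "x \<squnion> y = s"
  using assms by (intro le_antisym join_le assms(6)) (auto intro: join_left join_right)

lemma (in lattice) meet_eqI:
  assumes "x \<in> carrier L" "y \<in> carrier L" "s \<in> carrier L" "s \<sqsubseteq> x" "s \<sqsubseteq> y"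
    and "\<And>z. z \<in> carrier L \<Longrightarrow> z \<sqsubseteq> x \<Longrightarrow> z \<sqsubseteq> y \<Longrightarrow> z \<sqsubseteq> s"
  shows "x \<sqinter> y = s"
  using assms by (intro le_antisym meet_le assms(6)) (auto intro: meet_left meet_right)

lemma (in partial_order) latticeI:
  assumes sup: "\<And>x y. x \<in> carrier L \<Longrightarrow> y \<in> carrier L \<Longrightarrow>
      \<exists>s\<in>carrier L. x \<sqsubseteq> s \<and> y \<sqsubseteq> s \<and> (\<forall>z\<in>carrier L. x \<sqsubseteq> z \<and> y \<sqsubseteq> z \<longrightarrow> s \<sqsubseteq> z)"
    and inf: "\<And>x y. x \<in> carrier L \<Longrightarrow> y \<in> carrier L \<Longrightarrow>
      \<exists>s\<in>carrier L. s \<sqsubseteq> x \<and> s \<sqsubseteq> y \<and> (\<forall>z\<in>carrier L. z \<sqsubseteq> x \<and> z \<sqsubseteq> y \<longrightarrow> z \<sqsubseteq> s)"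
  shows "lattice L"
proof (intro lattice.intro upper_semilattice.intro lower_semilattice.intro partial_order_axioms
    upper_semilattice_axioms.intro lower_semilattice_axioms.intro)
  fix x y assume "x \<in> carrier L" "y \<in> carrier L"
  then show "\<exists>s. least L s (Upper L {x, y})" and "\<exists>s. greatest L s (Lower L {x, y})"
    using sup[of x y] inf[of x y] by (auto simp: least_def Upper_def greatest_def Lower_def)
qed

context abelian_lgroup
begin

section \<open>Cosets of an ideal and their order\<close>

context
  fixes K assumes K: "lideal G K"
begin

interpretation K: normal K G
  using K by (intro subgroup_imp_normal lideal_subgroup)

lemma coset_eq_iff:
  assumes "a \<in> carrier G" "b \<in> carrier G"
  shows "K #> a = K #> b \<longleftrightarrow> (\<exists>k\<in>K. a = k \<otimes> b)"
proof
  assume "K #> a = K #> b"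
  then have "a \<in> K #> b" using assms rcos_self[OF _ K.subgroup_axioms, of a] by simp
  then show "\<exists>k\<in>K. a = k \<otimes> b" by (auto simp: r_coset_def)
next
  assume "\<exists>k\<in>K. a = k \<otimes> b"
  then have "a \<in> K #> b" by (auto simp: r_coset_def)
  then show "K #> a = K #> b" using repr_independence[of a K b] assms K.subgroup_axioms by simp
qed

lemma coset_self_iff: "a \<in> carrier G \<Longrightarrow> K #> a = K \<longleftrightarrow> a \<in> K"
  using coset_join1[of K a] coset_join2[of a K] K.subgroup_axioms K.subset by blast

lemma coset_one [simp]: "K #> \<one> = K"
  by (simp add: coset_self_iff)

lemma coset_closed [simp]: "a \<in> carrier G \<Longrightarrow> K #> a \<in> rcosets K"
  by (simp add: rcosetsI K.subset)

lemma rcosetsE: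
  assumes "A \<in> rcosets K"
  obtains a where "a \<in> carrier G" "A = K #> a"
  using assms by (auto simp: RCOSETS_def)

text \<open>The quotient order allows an error from K on each side; subtracting the left one leaves
  a single error on the right. Inequalities between cosets thereby become inequalities in G.\<close>

lemma coset_le_iff:
  assumes ab: "a \<in> carrier G" "b \<in> carrier G"
  shows "ole (lquotient G K) (K #> a) (K #> b) \<longleftrightarrow> (\<exists>k\<in>K. a \<preceq> k \<otimes> b)"
proof
  assume "ole (lquotient G K) (K #> a) (K #> b)"
  then obtain k l where kl: "k \<in> K" "l \<in> K" "k \<otimes> a \<preceq> l \<otimes> b"
    by (auto simp: r_coset_def)
  then have "inv k \<otimes> (k \<otimes> a) \<preceq> inv k \<otimes> (l \<otimes> b)"
    using ab by (intro mult_mono[OF le_refl kl(3)]) auto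
  then have "a \<preceq> (inv k \<otimes> l) \<otimes> b" using kl ab by (simp add: m_assoc[symmetric])
  then show "\<exists>k\<in>K. a \<preceq> k \<otimes> b" using kl by blast
next
  assume "\<exists>k\<in>K. a \<preceq> k \<otimes> b"
  then obtain k where "k \<in> K" "a \<preceq> k \<otimes> b" by auto
  then show "ole (lquotient G K) (K #> a) (K #> b)"
    using ab rcosI[of k K b] rcos_self[OF ab(1) K.subgroup_axioms] K.subset by auto
qed

lemma coset_mono:
  "\<lbrakk>a \<preceq> b; a \<in> carrier G; b \<in> carrier G\<rbrakk> \<Longrightarrow> ole (lquotient G K) (K #> a) (K #> b)"
  by (subst coset_le_iff) (auto intro!: bexI[of _ \<one>])

lemma coset_mult: "\<lbrakk>a \<in> carrier G; b \<in> carrier G\<rbrakk> \<Longrightarrow>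
    (K #> a) \<otimes>\<^bsub>lquotient G K\<^esub> (K #> b) = K #> (a \<otimes> b)"
  by (simp add: K.rcos_sum)

lemma comm_group_lquotient: "comm_group (lquotient G K)"
proof (rule comm_groupI)
  show "\<exists>y\<in>carrier (lquotient G K). y \<otimes>\<^bsub>lquotient G K\<^esub> x = \<one>\<^bsub>lquotient G K\<^esub>"
    if x: "x \<in> carrier (lquotient G K)" for x
  proof -
    obtain a where "a \<in> carrier G" "x = K #> a" using x by (auto elim!: rcosetsE)
    then show ?thesis by (intro bexI[of _ "K #> inv a"]) (simp_all add: K.rcos_sum)
  qed
  show "\<one>\<^bsub>lquotient G K\<^esub> \<in> carrier (lquotient G K)"
    using coset_closed[OF one_closed] by simp
  show "\<one>\<^bsub>lquotient G K\<^esub> \<otimes>\<^bsub>lquotient G K\<^esub> x = x" if "x \<in> carrier (lquotient G K)" for x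
    using that coset_mult[OF one_closed] by (auto elim!: rcosetsE)
qed (auto elim!: rcosetsE simp: K.rcos_sum m_ac)

text \<open>The two inequalities hold with different errors k and l. Their join is again in K, as an
  ideal is a sublattice, and it serves as a common error for the universal property of the join in
  G.\<close>

lemma coset_jn_least:
  assumes "a \<in> carrier G" "b \<in> carrier G" "c \<in> carrier G"
    and "ole (lquotient G K) (K #> a) (K #> c)" "ole (lquotient G K) (K #> b) (K #> c)"
  shows "ole (lquotient G K) (K #> jn a b) (K #> c)"
proof -
  obtain k l where kl: "k \<in> K" "a \<preceq> k \<otimes> c" "l \<in> K" "b \<preceq> l \<otimes> c"
    using assms by (auto simp: coset_le_iff simp del: lquotient_simps)
  have "k \<otimes> c \<preceq> jn k l \<otimes> c" "l \<otimes> c \<preceq> jn k l \<otimes> c"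
    using kl assms by (auto intro!: translate jn_ub1 jn_ub2)
  then have "a \<preceq> jn k l \<otimes> c" "b \<preceq> jn k l \<otimes> c"
    using kl assms le_trans[of a "k \<otimes> c"] le_trans[of b "l \<otimes> c"] by auto
  then have "jn a b \<preceq> jn k l \<otimes> c" using assms kl by (intro jn_least) auto
  moreover have "jn k l \<in> K" using kl K by (simp add: lideal_jn)
  ultimately show ?thesis using assms coset_le_iff[of "jn a b" c] by auto
qed

lemma coset_mt_greatest:
  assumes "a \<in> carrier G" "b \<in> carrier G" "c \<in> carrier G"
    and "ole (lquotient G K) (K #> c) (K #> a)" "ole (lquotient G K) (K #> c) (K #> b)"
  shows "ole (lquotient G K) (K #> c) (K #> mt a b)"
proof -
  obtain k l where kl: "k \<in> K" "c \<preceq> k \<otimes> a" "l \<in> K" "c \<preceq> l \<otimes> b"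
    using assms by (auto simp: coset_le_iff simp del: lquotient_simps)
  \<comment> \<open>The errors are joined here too, although a meet is formed: both sit on the
    larger side. The common error is moved to the left before the meet in G is used.\<close>
  have "k \<otimes> a \<preceq> jn k l \<otimes> a" "l \<otimes> b \<preceq> jn k l \<otimes> b"
    using kl assms by (auto intro!: translate jn_ub1 jn_ub2)
  then have "c \<preceq> jn k l \<otimes> a" "c \<preceq> jn k l \<otimes> b"
    using kl assms le_trans[of c "k \<otimes> a"] le_trans[of c "l \<otimes> b"] by auto
  then have "c \<otimes> inv (jn k l) \<preceq> a" "c \<otimes> inv (jn k l) \<preceq> b"
    using kl assms by (simp_all add: inv_shift_right m_comm)
  then have "c \<otimes> inv (jn k l) \<preceq> mt a b" using assms kl by (intro mt_greatest) auto
  then have "c \<preceq> jn k l \<otimes> mt a b" using assms kl by (simp add: inv_shift_right m_comm)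
  moreover have "jn k l \<in> K" using kl K by (simp add: lideal_jn)
  ultimately show ?thesis using assms coset_le_iff[of c "mt a b"] by auto
qed

lemma partial_order_lquotient: "partial_order (ord_of (lquotient G K))"
proof -
  have trans: "ole (lquotient G K) (K #> a) (K #> c)"
    if carr: "a \<in> carrier G" "b \<in> carrier G" "c \<in> carrier G"
      and le: "ole (lquotient G K) (K #> a) (K #> b)" "ole (lquotient G K) (K #> b) (K #> c)"
    for a b c
  proof -
    obtain k l where kl: "k \<in> K" "a \<preceq> k \<otimes> b" "l \<in> K" "b \<preceq> l \<otimes> c"
      using le carr by (auto simp: coset_le_iff simp del: lquotient_simps)
    then have "k \<otimes> b \<preceq> k \<otimes> (l \<otimes> c)" using carr by (intro mult_mono) auto
    then have "a \<preceq> (k \<otimes> l) \<otimes> c"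
      using kl carr le_trans[of a "k \<otimes> b" "k \<otimes> (l \<otimes> c)"] by (simp add: m_assoc)
    then show ?thesis using kl carr unfolding coset_le_iff[OF carr(1,3)] by blast
  qed
  have antisym: "K #> a = K #> b"
    if carr: "a \<in> carrier G" "b \<in> carrier G"
      and le: "ole (lquotient G K) (K #> a) (K #> b)" "ole (lquotient G K) (K #> b) (K #> a)"
    for a b
  proof -
    obtain k l where kl: "k \<in> K" "a \<preceq> k \<otimes> b" "l \<in> K" "b \<preceq> l \<otimes> a"
      using le carr by (auto simp: coset_le_iff simp del: lquotient_simps)
    \<comment> \<open>The difference a - b is caught between -l and k, so convexity puts it in
      K.\<close>
    have "a \<otimes> inv b \<preceq> k" using kl carr by (simp add: inv_shift_right)
    moreover have "b \<otimes> inv a \<preceq> l" using kl carr by (simp add: inv_shift_right)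
    then have "inv l \<preceq> a \<otimes> inv b"
      using inv_antimono[of "b \<otimes> inv a" l] kl carr by (simp add: inv_mult m_comm)
    ultimately have "a \<otimes> inv b \<in> K"
      using lideal_convex[OF K, of "inv l" "a \<otimes> inv b" k] kl carr by simp
    then show ?thesis
      using carr unfolding coset_eq_iff[OF carr] by (intro bexI[of _ "a \<otimes> inv b"]) (auto simp: m_assoc)
  qed
  show ?thesis
  proof unfold_locales
    show "x .=\<^bsub>ord_of (lquotient G K)\<^esub> y"
      if h: "x \<sqsubseteq>\<^bsub>ord_of (lquotient G K)\<^esub> y" "y \<sqsubseteq>\<^bsub>ord_of (lquotient G K)\<^esub> x"
        "x \<in> carrier (ord_of (lquotient G K))" "y \<in> carrier (ord_of (lquotient G K))" for x y
    proof -
      obtain a b where "a \<in> carrier G" "x = K #> a" "b \<in> carrier G" "y = K #> b"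
        using h(3,4) by (auto elim!: rcosetsE)
      then show ?thesis using antisym[of a b] h(1,2) by simp
    qed
    show "x \<sqsubseteq>\<^bsub>ord_of (lquotient G K)\<^esub> z"
      if h: "x \<sqsubseteq>\<^bsub>ord_of (lquotient G K)\<^esub> y" "y \<sqsubseteq>\<^bsub>ord_of (lquotient G K)\<^esub> z"
        "x \<in> carrier (ord_of (lquotient G K))" "y \<in> carrier (ord_of (lquotient G K))"
        "z \<in> carrier (ord_of (lquotient G K))" for x y z
    proof -
      obtain a b c where "a \<in> carrier G" "x = K #> a" "b \<in> carrier G" "y = K #> b"
          "c \<in> carrier G" "z = K #> c"
        using h(3-5) by (auto elim!: rcosetsE)
      then show ?thesis using trans[of a b c] h(1,2) by simp
    qed
  qed (auto elim!: rcosetsE intro: coset_mono simp del: lquotient_simps(4))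
qed

lemma abelian_lgroup_lquotient: "abelian_lgroup (lquotient G K)"
proof -
  have lat: "lattice (ord_of (lquotient G K))"
  proof (rule partial_order.latticeI[OF partial_order_lquotient])
    fix x y assume "x \<in> carrier (ord_of (lquotient G K))" "y \<in> carrier (ord_of (lquotient G K))"
    then obtain a b where ab: "a \<in> carrier G" "x = K #> a" "b \<in> carrier G" "y = K #> b"
      by (auto elim!: rcosetsE)
    show "\<exists>s\<in>carrier (ord_of (lquotient G K)).
        x \<sqsubseteq>\<^bsub>ord_of (lquotient G K)\<^esub> s \<and> y \<sqsubseteq>\<^bsub>ord_of (lquotient G K)\<^esub> s
        \<and> (\<forall>z\<in>carrier (ord_of (lquotient G K)).
          x \<sqsubseteq>\<^bsub>ord_of (lquotient G K)\<^esub> z \<and> y \<sqsubseteq>\<^bsub>ord_of (lquotient G K)\<^esub> z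
            \<longrightarrow> s \<sqsubseteq>\<^bsub>ord_of (lquotient G K)\<^esub> z)"
      using ab by (intro bexI[of _ "K #> jn a b"])
        (auto elim!: rcosetsE intro: coset_mono jn_ub1 jn_ub2 coset_jn_least
          simp del: lquotient_simps(4))
    show "\<exists>s\<in>carrier (ord_of (lquotient G K)).
        s \<sqsubseteq>\<^bsub>ord_of (lquotient G K)\<^esub> x \<and> s \<sqsubseteq>\<^bsub>ord_of (lquotient G K)\<^esub> y
        \<and> (\<forall>z\<in>carrier (ord_of (lquotient G K)).
          z \<sqsubseteq>\<^bsub>ord_of (lquotient G K)\<^esub> x \<and> z \<sqsubseteq>\<^bsub>ord_of (lquotient G K)\<^esub> y
            \<longrightarrow> z \<sqsubseteq>\<^bsub>ord_of (lquotient G K)\<^esub> s)"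
      using ab by (intro bexI[of _ "K #> mt a b"])
        (auto elim!: rcosetsE intro: coset_mono mt_lb1 mt_lb2 coset_mt_greatest
          simp del: lquotient_simps(4))
  qed
  have translate': "ole (lquotient G K) (x \<otimes>\<^bsub>lquotient G K\<^esub> z) (y \<otimes>\<^bsub>lquotient G K\<^esub> z)"
    if xyz: "x \<in> carrier (lquotient G K)" "y \<in> carrier (lquotient G K)" "z \<in> carrier (lquotient G K)"
      and le: "ole (lquotient G K) x y" for x y z
  proof -
    obtain a b c where abc: "a \<in> carrier G" "b \<in> carrier G" "c \<in> carrier G"
        "x = K #> a" "y = K #> b" "z = K #> c"
      using xyz by (auto elim!: rcosetsE)
    obtain k where k: "k \<in> K" "a \<preceq> k \<otimes> b"
      using le abc coset_le_iff[of a b] by auto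
    then have "a \<otimes> c \<preceq> k \<otimes> (b \<otimes> c)"
      using abc translate[of a "k \<otimes> b" c] by (simp add: m_assoc)
    then show ?thesis
      using k abc coset_le_iff[of "a \<otimes> c" "b \<otimes> c"] by (auto simp: K.rcos_sum)
  qed
  show ?thesis
    by (intro abelian_lgroup.intro abelian_lgroup_axioms.intro comm_group_lquotient lat translate')
qed

lemma coset_lhom: "(\<lambda>a. K #> a) \<in> lhom G (lquotient G K)"
proof -
  interpret Q: abelian_lgroup "lquotient G K" by (rule abelian_lgroup_lquotient)
  have "(K #> a) \<squnion>\<^bsub>ord_of (lquotient G K)\<^esub> (K #> b) = K #> jn a b"
    if "a \<in> carrier G" "b \<in> carrier G" for a b
    by (rule Q.ord.join_eqI)
      (use that in \<open>auto elim!: rcosetsE intro: coset_mono jn_ub1 jn_ub2 coset_jn_least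
          simp del: lquotient_simps(4)\<close>)
  moreover have "(K #> a) \<sqinter>\<^bsub>ord_of (lquotient G K)\<^esub> (K #> b) = K #> mt a b"
    if "a \<in> carrier G" "b \<in> carrier G" for a b
    by (rule Q.ord.meet_eqI)
      (use that in \<open>auto elim!: rcosetsE intro: coset_mono mt_lb1 mt_lb2 coset_mt_greatest
          simp del: lquotient_simps(4)\<close>)
  ultimately show ?thesis
    using Q.is_lattice is_lattice
    by (auto simp: lhom_def hom_def join_pres_def meet_pres_def K.rcos_sum)
qed

lemma coset_pow: "a \<in> carrier G \<Longrightarrow> (K #> a) [^]\<^bsub>lquotient G K\<^esub> (n::nat) = K #> (a [^] n)"
proof -
  interpret Q: abelian_lgroup "lquotient G K" by (rule abelian_lgroup_lquotient)
  assume "a \<in> carrier G"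
  then show ?thesis by (induction n) (auto simp: K.rcos_sum)
qed

lemma coset_inv: "a \<in> carrier G \<Longrightarrow> inv\<^bsub>lquotient G K\<^esub> (K #> a) = K #> inv a"
proof -
  interpret Q: abelian_lgroup "lquotient G K" by (rule abelian_lgroup_lquotient)
  assume "a \<in> carrier G"
  then show ?thesis by (intro Q.inv_equality) (auto simp: K.rcos_sum)
qed

lemma archimedean_lquotientI:
  assumes arch: "\<And>a b. \<lbrakk>a \<in> carrier G; b \<in> carrier G; ole (lquotient G K) K (K #> a);
      \<And>n::nat. ole (lquotient G K) (K #> (a [^] n)) (K #> b)\<rbrakk> \<Longrightarrow> a \<in> K"
  shows "archimedean_lgroup (lquotient G K)"
proof (intro archimedean_lgroup.intro abelian_lgroup_lquotient archimedean_lgroup_axioms.intro)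
  fix x y
  assume xy: "x \<in> carrier (lquotient G K)" "y \<in> carrier (lquotient G K)"
    and pos: "ole (lquotient G K) \<one>\<^bsub>lquotient G K\<^esub> x"
    and bound: "\<And>n::nat. ole (lquotient G K) (x [^]\<^bsub>lquotient G K\<^esub> n) y"
  obtain a b where ab: "a \<in> carrier G" "b \<in> carrier G" "x = K #> a" "y = K #> b"
    using xy by (auto elim!: rcosetsE)
  have "ole (lquotient G K) K (K #> a)"
    using pos ab by simp
  moreover have "ole (lquotient G K) (K #> (a [^] n)) (K #> b)" for n :: nat
    using bound[of n] ab by (simp add: coset_pow del: lquotient_simps(4))
  ultimately have "a \<in> K" using arch ab by blast
  then show "x = \<one>\<^bsub>lquotient G K\<^esub>" using ab by (simp add: coset_self_iff)
qed

end

end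

section \<open>Maximal ideals\<close>

lemma (in abelian_lgroup) lideal_Union_chain:
  assumes nonempty: "\<C> \<noteq> {}" and chain: "subset.chain \<A> \<C>"
    and ideals: "\<And>I. I \<in> \<C> \<Longrightarrow> lideal G I"
  shows "lideal G (\<Union>\<C>)"
proof -
  have two: "\<exists>I\<in>\<C>. x \<in> I \<and> y \<in> I" if "x \<in> \<Union>\<C>" "y \<in> \<Union>\<C>" for x y
  proof -
    obtain I J where IJ: "I \<in> \<C>" "x \<in> I" "J \<in> \<C>" "y \<in> J" using \<open>x \<in> \<Union>\<C>\<close> \<open>y \<in> \<Union>\<C>\<close> by blast
    then have "I \<subseteq> J \<or> J \<subseteq> I" using chain by (auto simp: subset_chain_def)
    then show ?thesis using IJ by blast
  qed
  have "subgroup (\<Union>\<C>) G"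
  proof (rule subgroupI)
    show "\<Union>\<C> \<subseteq> carrier G" using ideals lideal_carrier by blast
    show "\<Union>\<C> \<noteq> {}" using nonempty ideals lideal_one by blast
    show "inv x \<in> \<Union>\<C>" if "x \<in> \<Union>\<C>" for x using that ideals lideal_inv by blast
    show "x \<otimes> y \<in> \<Union>\<C>" if "x \<in> \<Union>\<C>" "y \<in> \<Union>\<C>" for x y
      using two[OF that] ideals lideal_mult by blast
  qed
  moreover have "jn x y \<in> \<Union>\<C> \<and> mt x y \<in> \<Union>\<C>" if "x \<in> \<Union>\<C>" "y \<in> \<Union>\<C>" for x y
    using two[OF that] ideals lideal_jn lideal_mt by blast
  moreover have "z \<in> \<Union>\<C>" if "x \<in> \<Union>\<C>" "y \<in> \<Union>\<C>" "z \<in> carrier G" "x \<preceq> z \<and> z \<preceq> y" for x y z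
    using two[OF that(1,2)] that(3,4) ideals lideal_convex by blast
  ultimately show ?thesis
    unfolding lideal_def by (intro conjI ballI impI) (assumption | blast)+
qed

context wstar
begin

lemma unit_bound:
  assumes f: "f \<in> carrier G"
  obtains n :: nat where "n > 0" "f \<preceq> u [^] n" "inv f \<preceq> u [^] n"
  using f mem_principal_lideal_iff[of u f] unit_closed unit_nonneg
  by (auto simp: strong_unit labs_of_one_le)

text \<open>An ideal containing u contains G(u), which is all of G. So omitting u means being
  proper, and the points of the Yosida space are the maximal ideals that \<open>class_Y\<close>
  speaks of.\<close>

lemma unit_mem_lideal_iff:
  assumes I: "lideal G I"
  shows "u \<in> I \<longleftrightarrow> I = carrier G"
proof
  assume "u \<in> I"
  then show "I = carrier G"
    using principal_lideal_least[OF I] strong_unit lideal_carrier[OF I] by blast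
qed (simp add: unit_closed)

lemma yosida_points_eq_maximal: "yosida_points G u = {M. maximal_lideal G M}"
  by (auto simp: yosida_points_def maximal_lideal_def unit_mem_lideal_iff)

lemma yosida_points_lideal: "M \<in> yosida_points G u \<Longrightarrow> lideal G M"
  and yosida_points_unit: "M \<in> yosida_points G u \<Longrightarrow> u \<notin> M"
  and yosida_points_max: "\<lbrakk>M \<in> yosida_points G u; lideal G N; u \<notin> N; M \<subseteq> N\<rbrakk> \<Longrightarrow> N = M"
  by (auto simp: yosida_points_def)

lemma extend_to_yosida_point:
  assumes I: "lideal G I" "u \<notin> I"
  obtains M where "M \<in> yosida_points G u" "I \<subseteq> M"
proof -
  define \<A> where "\<A> = {N. lideal G N \<and> u \<notin> N \<and> I \<subseteq> N}"
  have "\<exists>M\<in>\<A>. \<forall>N\<in>\<A>. M \<subseteq> N \<longrightarrow> N = M"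
  proof (rule subset_Zorn_nonempty)
    show "\<A> \<noteq> {}" using I by (auto simp: \<A>_def)
    fix \<C> assume C: "\<C> \<noteq> {}" "subset.chain \<A> \<C>"
    then have sub: "\<C> \<subseteq> \<A>" by (simp add: subset_chain_def)
    then have "lideal G (\<Union>\<C>)"
      using C by (intro lideal_Union_chain) (auto simp: \<A>_def)
    then show "\<Union>\<C> \<in> \<A>" using C(1) sub unfolding \<A>_def by blast
  qed
  then obtain M where M: "M \<in> \<A>" "\<And>N. N \<in> \<A> \<Longrightarrow> M \<subseteq> N \<Longrightarrow> N = M" by blast
  then have "M \<in> yosida_points G u" "I \<subseteq> M"
    by (auto simp: \<A>_def yosida_points_def)
  then show thesis by (rule that)
qed

text \<open>Maximality in quantitative form: adjoining p to M must bring in u. It is used both for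
  totality of G/M and for the absence of infinitesimals there.\<close>

lemma unit_le_outside:
  assumes M: "M \<in> yosida_points G u" and p: "p \<in> carrier G" "\<one> \<preceq> p" "p \<notin> M"
  obtains n :: nat and m where "m \<in> M" "\<one> \<preceq> m" "u \<preceq> p [^] n \<otimes> m"
proof -
  note adj = lideal_adjoin[OF yosida_points_lideal[OF M] p(1,2)]
  have "u \<in> adjoin M p"
    using yosida_points_max[OF M adj(1) _ adj(2)] adj(3) p(3) by auto
  then show thesis using that by (auto simp: adjoin_def bounded_by_def)
qed

text \<open>If it fails, neither the positive part p nor the negative part q of x is in M, so u is
  below a multiple of each up to errors m and l. These multiples are disjoint, whence u <= m + l and
  u is in M.\<close>

lemma yosida_point_total:
  assumes M: "M \<in> yosida_points G u" and x: "x \<in> carrier G"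
  shows "(\<exists>m\<in>M. x \<preceq> m) \<or> (\<exists>m\<in>M. inv x \<preceq> m)"
proof (rule ccontr)
  assume contra: "\<not> ?thesis"
  note I = yosida_points_lideal[OF M] and carr = lideal_carrier[OF yosida_points_lideal[OF M]]
  define p q where "p = jn x \<one>" and "q = jn (inv x) \<one>"
  have pq: "p \<in> carrier G" "q \<in> carrier G" "\<one> \<preceq> p" "\<one> \<preceq> q" "x \<preceq> p" "inv x \<preceq> q"
    using x by (auto simp: p_def q_def jn_ub1 jn_ub2)
  have "p \<notin> M" "q \<notin> M" using contra pq by blast+
  obtain n m where m: "m \<in> M" "\<one> \<preceq> m" "u \<preceq> p [^] (n::nat) \<otimes> m"
    by (rule unit_le_outside[OF M pq(1,3) \<open>p \<notin> M\<close>])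
  obtain k l where l: "l \<in> M" "\<one> \<preceq> l" "u \<preceq> q [^] (k::nat) \<otimes> l"
    by (rule unit_le_outside[OF M pq(2,4) \<open>q \<notin> M\<close>])
  have ml: "m \<in> carrier G" "l \<in> carrier G" using m l carr by auto
  have "disj (p [^] n) (q [^] k)"
    using disj_pow[OF disj_sym[OF disj_pow[OF disj_sym[OF disj_pos_neg[OF x]]]]] x pq
    unfolding p_def q_def by blast
  \<comment> \<open>With the common error m + l, the single element u - (m + l) lies below both
    disjoint multiples.\<close>
  moreover have "u \<preceq> p [^] n \<otimes> (m \<otimes> l)"
    using le_mult_one_le[OF m(3) l(2)] unit_closed pq ml by (simp add: m_assoc)
  then have "u \<otimes> inv (m \<otimes> l) \<preceq> p [^] n"
    using unit_closed pq ml by (simp add: inv_shift_right)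
  moreover have "u \<preceq> q [^] k \<otimes> (m \<otimes> l)"
    using le_mult_one_le[OF l(3) m(2)] unit_closed pq ml by (simp add: m_ac)
  then have "u \<otimes> inv (m \<otimes> l) \<preceq> q [^] k"
    using unit_closed pq ml by (simp add: inv_shift_right)
  ultimately have "u \<otimes> inv (m \<otimes> l) \<preceq> \<one>"
    using unit_closed ml by (simp add: disj_def)
  then have "u \<preceq> m \<otimes> l" using unit_closed ml by (simp add: inv_shift_right)
  then have "u \<in> M"
    using lideal_convex[OF I unit_nonneg _ lideal_one[OF I] lideal_mult[OF I m(1) l(1)]] unit_closed
    by blast
  then show False using yosida_points_unit[OF M] by simp
qed

text \<open>
  Put \<open>w = n|f| - u\<close>. If u were in the ideal generated by K and \<open>w\<^sup>-\<close>, then \<open>w\<^sup>+ \<le> k u\<close> would be below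
  a multiple of \<open>w\<^sup>-\<close> plus some c in K; as \<open>w\<^sup>+\<close> and \<open>w\<^sup>-\<close> are disjoint, this gives \<open>w\<^sup>+ \<le> c\<close>, so
  \<open>w\<^sup>+ \<in> K\<close> and \<open>n|f| \<le> u\<close> modulo K.
\<close>

lemma archimedean_quotient_separates:
  assumes K: "lideal G K" and arch: "archimedean_lgroup (lquotient G K)"
    and f: "f \<in> carrier G" "f \<notin> K"
  obtains M where "M \<in> yosida_points G u" "K \<subseteq> M" "f \<notin> M"
proof -
  interpret Q: archimedean_lgroup "lquotient G K" by (rule arch)
  define a where "a = labs G f"
  have a: "a \<in> carrier G" "\<one> \<preceq> a" "a \<notin> K"
    using f lideal_labsD[OF K] by (auto simp: a_def one_le_labs)
  have pos: "ole (lquotient G K) (K #> \<one>) (K #> a)"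
    by (rule coset_mono[OF K a(2)]) (use a in auto)
  have "\<exists>n::nat. \<not> ole (lquotient G K) (K #> (a [^] n)) (K #> u)"
  proof (rule ccontr)
    assume "\<not> ?thesis"
    then have "K #> a = \<one>\<^bsub>lquotient G K\<^esub>"
      using pos K a unit_closed
      by (intro Q.archimedean[of _ "K #> u"])
        (simp_all add: coset_pow del: lquotient_simps(4))
    then show False using a coset_self_iff[OF K] by simp
  qed
  then obtain n :: nat where n: "\<not> ole (lquotient G K) (K #> (a [^] n)) (K #> u)" by blast
  define w where "w = a [^] n \<otimes> inv u"
  have w: "w \<in> carrier G" using a unit_closed by (simp add: w_def)
  define p q where "p = jn w \<one>" and "q = jn (inv w) \<one>"
  have pq: "p \<in> carrier G" "q \<in> carrier G" "\<one> \<preceq> p" "\<one> \<preceq> q" "w \<preceq> p" "inv w \<preceq> q"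
    using w by (auto simp: p_def q_def jn_ub1 jn_ub2)
  have "p \<notin> K"
  proof
    assume "p \<in> K"
    moreover have "a [^] n \<preceq> p \<otimes> u"
      using pq(1,5) a unit_closed unfolding w_def by (simp add: inv_shift_right)
    ultimately show False using n coset_le_iff[OF K] a unit_closed by blast
  qed
  have "u \<notin> adjoin K q"
  proof
    assume "u \<in> adjoin K q"
    then obtain m :: nat and c where c: "c \<in> K" "\<one> \<preceq> c" "u \<preceq> q [^] m \<otimes> c"
      by (auto simp: adjoin_def bounded_by_def)
    have cc: "c \<in> carrier G" using c lideal_carrier[OF K] by auto
    obtain k :: nat where k: "p \<preceq> u [^] k" using unit_bound[OF pq(1)] by blast
    have "u [^] k \<preceq> (q [^] m \<otimes> c) [^] k"
      using c cc unit_closed pq by (intro pow_mono) auto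
    then have "p \<preceq> q [^] (m * k) \<otimes> c [^] k"
      using le_trans[OF k] pq cc unit_closed by (simp add: nat_pow_distrib nat_pow_pow)
    then have "p \<otimes> inv (c [^] k) \<preceq> q [^] (m * k)"
      using pq cc by (simp add: inv_shift_right)
    moreover have "p \<otimes> inv (c [^] k) \<preceq> p"
      using pq cc le_mult_one_le[of p p "c [^] k"] one_le_pow[OF c(2) cc]
      by (simp add: inv_shift_right)
    moreover have "disj p (q [^] (m * k))"
      using disj_pow[OF disj_pos_neg[OF w]] w pq unfolding p_def q_def by simp
    ultimately have "p \<otimes> inv (c [^] k) \<preceq> \<one>" using pq cc by (simp add: disj_def)
    then have "p \<preceq> c [^] k" using pq cc by (simp add: inv_shift_right)
    then have "p \<in> K"
      using lideal_convex[OF K pq(3) _ lideal_one[OF K] lideal_pow[OF K c(1)]] pq by blast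
    with \<open>p \<notin> K\<close> show False ..
  qed
  then obtain M where M: "M \<in> yosida_points G u" "adjoin K q \<subseteq> M"
    using extend_to_yosida_point lideal_adjoin(1)[OF K pq(2,4)] by metis
  have I: "lideal G M" using M yosida_points_lideal by auto
  have "f \<notin> M"
  proof
    assume "f \<in> M"
    then have "a \<in> M" using I lideal_labs a_def by auto
    moreover have "q \<in> M" using M lideal_adjoin(3)[OF K pq(2,4)] by blast
    ultimately have "q \<otimes> a [^] n \<in> M" using I lideal_mult lideal_pow by auto
    \<comment> \<open>The negative part q dominates -w = u - n|f|, so u <= q + n|f|, and both
      summands lie in M.\<close>
    moreover have "inv w = u \<otimes> inv (a [^] n)"
      using a unit_closed by (simp add: w_def inv_mult m_comm)
    then have "u \<preceq> q \<otimes> a [^] n"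
      using pq a unit_closed by (simp add: inv_shift_right)
    ultimately have "u \<in> M"
      using lideal_convex[OF I unit_nonneg _ lideal_one[OF I]] unit_closed by blast
    then show False using yosida_points_unit M by blast
  qed
  moreover have "K \<subseteq> M" using M lideal_adjoin(2)[OF K pq(2,4)] by blast
  ultimately show thesis using that M by blast
qed

end

section \<open>Hoelder's theorem and the Yosida values\<close>

lemma real_lgroup_simps [simp]:
  "carrier real_lgroup = UNIV" "mult real_lgroup = (+)" "one real_lgroup = 0"
  "ole real_lgroup = (\<le>)"
  by (simp_all add: real_lgroup_def)

lemma lattice_real_lgroup: "lattice (ord_of real_lgroup)"
proof (rule partial_order.latticeI)
  show "partial_order (ord_of real_lgroup)" by unfold_locales auto
  fix x y :: real
  show "\<exists>s\<in>carrier (ord_of real_lgroup).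
      x \<sqsubseteq>\<^bsub>ord_of real_lgroup\<^esub> s \<and> y \<sqsubseteq>\<^bsub>ord_of real_lgroup\<^esub> s
      \<and> (\<forall>z\<in>carrier (ord_of real_lgroup).
        x \<sqsubseteq>\<^bsub>ord_of real_lgroup\<^esub> z \<and> y \<sqsubseteq>\<^bsub>ord_of real_lgroup\<^esub> z \<longrightarrow> s \<sqsubseteq>\<^bsub>ord_of real_lgroup\<^esub> z)"
    by (intro bexI[of _ "max x y"]) auto
  show "\<exists>s\<in>carrier (ord_of real_lgroup).
      s \<sqsubseteq>\<^bsub>ord_of real_lgroup\<^esub> x \<and> s \<sqsubseteq>\<^bsub>ord_of real_lgroup\<^esub> y
      \<and> (\<forall>z\<in>carrier (ord_of real_lgroup).
        z \<sqsubseteq>\<^bsub>ord_of real_lgroup\<^esub> x \<and> z \<sqsubseteq>\<^bsub>ord_of real_lgroup\<^esub> y \<longrightarrow> z \<sqsubseteq>\<^bsub>ord_of real_lgroup\<^esub> s)"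
    by (intro bexI[of _ "min x y"]) auto
qed

lemma real_lgroup_join: "x \<squnion>\<^bsub>ord_of real_lgroup\<^esub> y = max x y"
  and real_lgroup_meet: "x \<sqinter>\<^bsub>ord_of real_lgroup\<^esub> y = min x y"
  by (rule lattice.join_eqI[OF lattice_real_lgroup] lattice.meet_eqI[OF lattice_real_lgroup]; simp)+

text \<open>Identities between the real numbers constructed below are known only up to an error c/n
  for each n; this removes the error.\<close>

lemma zero_if_abs_le_fractions:
  fixes d c :: real
  assumes "\<And>n::int. n > 0 \<Longrightarrow> \<bar>d\<bar> \<le> c / of_int n"
  shows "d = 0"
proof (rule ccontr)
  assume "d \<noteq> 0"
  then obtain n :: nat where n: "c < of_nat n * \<bar>d\<bar>" using ex_less_of_nat_mult[of "\<bar>d\<bar>" c] by auto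
  \<comment> \<open>The index found may be 0, where the assumption says nothing, so its successor is
    used.\<close>
  have "\<bar>d\<bar> \<le> c / of_int (int (Suc n))" by (rule assms) simp
  then have "of_nat (Suc n) * \<bar>d\<bar> \<le> c" by (simp add: field_simps)
  moreover have "of_nat n * \<bar>d\<bar> \<le> of_nat (Suc n) * \<bar>d\<bar>" by (intro mult_right_mono) auto
  ultimately show False using n by linarith
qed

text \<open>The setting of Hoelder's theorem, to be instantiated with G/M. The Archimedean property
  appears relative to u, in the form that maximality of M delivers.\<close>

locale holder = abelian_lgroup +
  fixes u
  assumes total: "\<lbrakk>x \<in> carrier G; y \<in> carrier G\<rbrakk> \<Longrightarrow> x \<preceq> y \<or> y \<preceq> x"
    and unit_closed: "u \<in> carrier G"
    and unit_nonneg: "\<one> \<preceq> u"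
    and unit_nontrivial: "u \<noteq> \<one>"
    and unit_strong: "x \<in> carrier G \<Longrightarrow> \<exists>n::nat. x \<preceq> u [^] n"
    and no_infinitesimal: "\<lbrakk>x \<in> carrier G; \<one> \<preceq> x; x \<noteq> \<one>\<rbrakk> \<Longrightarrow> \<exists>n::nat. u \<preceq> x [^] n"
begin

section \<open>Multiples of the unit and comparison of fractions\<close>

lemma int_pow_mono:
  "\<lbrakk>x \<preceq> y; x \<in> carrier G; y \<in> carrier G; k \<ge> 0\<rbrakk> \<Longrightarrow> x [^] (k::int) \<preceq> y [^] k"
  by (cases k rule: nonneg_int_cases) (simp_all add: int_pow_int pow_mono)

lemma unit_pow_le_iff: "u [^] (i::int) \<preceq> u [^] j \<longleftrightarrow> i \<le> j"
proof -
  have le: "u [^] i \<preceq> u [^] j" if "i \<le> j" for i j :: int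
  proof -
    have "\<one> \<preceq> u [^] (j - i)"
      using int_pow_mono[of \<one> u "j - i"] unit_nonneg unit_closed that by simp
    then have "u [^] i \<preceq> u [^] i \<otimes> u [^] (j - i)"
      using unit_closed by (intro le_mult_one_le) auto
    then show ?thesis using unit_closed by (simp add: int_pow_mult[symmetric])
  qed
  moreover have False if "u [^] i \<preceq> u [^] j" "j < i"
  proof -
    have "u [^] (j + 1) \<preceq> u [^] j"
      using le_trans[OF le[of "j + 1" i] that(1)] that(2) unit_closed by simp
    then have "u \<otimes> u [^] j \<preceq> \<one> \<otimes> u [^] j" using unit_closed by (simp add: int_pow_mult m_comm)
    then have "u \<preceq> \<one> \<otimes> u [^] j \<otimes> inv (u [^] j)"
      using unit_closed le_shift_right[of u "\<one> \<otimes> u [^] j" "u [^] j"] by simp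
    then have "u \<preceq> \<one>" using unit_closed by simp
    then show False using unit_nonneg unit_nontrivial le_antisym unit_closed by auto
  qed
  ultimately show ?thesis by force
qed

text \<open>Cross-multiplication: m u <= n x times l and l x <= k u times n give m l u <= k n u, and
  multiples of u are ordered like the integers.\<close>

lemma cut_le:
  fixes m n k l :: int
  assumes "u [^] m \<preceq> x [^] n" "x [^] l \<preceq> u [^] k" "n > 0" "l > 0" "x \<in> carrier G"
  shows "real_of_int m / of_int n \<le> of_int k / of_int l"
proof -
  have "u [^] (m * l) \<preceq> x [^] (n * l)"
    using int_pow_mono[OF assms(1), of l] assms unit_closed by (simp add: int_pow_pow)
  moreover have "x [^] (n * l) \<preceq> u [^] (k * n)"
    using int_pow_mono[OF assms(2), of n] assms unit_closed by (simp add: int_pow_pow mult.commute)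
  ultimately have "u [^] (m * l) \<preceq> u [^] (k * n)"
    using le_trans assms unit_closed by (meson int_pow_closed)
  then have "m * l \<le> k * n" by (simp add: unit_pow_le_iff)
  then have "real_of_int m * of_int l \<le> of_int k * of_int n" by (metis of_int_le_iff of_int_mult)
  then show ?thesis using assms by (simp add: field_simps)
qed

text \<open>The multiples of u below y include -b u and stop at a u, so there is a last one.
  Totality turns the failure of the next multiple into an upper bound.\<close>

lemma unit_floor:
  assumes y: "y \<in> carrier G"
  obtains m :: int where "u [^] m \<preceq> y" "y \<preceq> u [^] (m + 1)"
proof -
  obtain a :: nat where a: "y \<preceq> u [^] a" using unit_strong[OF y] by auto
  obtain b :: nat where b: "inv y \<preceq> u [^] b" using unit_strong[of "inv y"] y by auto
  have lower: "u [^] (- int b) \<preceq> y"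
    using inv_antimono[OF b] y unit_closed by (simp add: int_pow_neg_int)
  have upper: "m \<le> int a" if "u [^] m \<preceq> y" for m :: int
    using le_trans[OF that a] y unit_closed unit_pow_le_iff[of m "int a"] by (simp add: int_pow_int)
  have "\<exists>m::int. u [^] m \<preceq> y \<and> \<not> u [^] (m + 1) \<preceq> y"
  proof (rule ccontr)
    assume step: "\<not> ?thesis"
    have "u [^] m \<preceq> y" if "- int b \<le> m" for m :: int
      using that by (induction m rule: int_ge_induct) (use lower step in auto)
    from upper[OF this, of "int a + 1"] show False by simp
  qed
  then obtain m :: int where "u [^] m \<preceq> y" "\<not> u [^] (m + 1) \<preceq> y" by blast
  then show thesis using that total[OF y, of "u [^] (m + 1)"] unit_closed by auto
qed

text \<open>Read additively, the condition is m u <= n x, so this is the Dedekind cut of x measured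
  in units of u.\<close>

definition ratio :: "'a \<Rightarrow> real"
  where "ratio x = Sup {real_of_int m / of_int n | m n. n > 0 \<and> u [^] m \<preceq> x [^] n}"

lemma ratio_lower:
  fixes m n :: int
  assumes "u [^] m \<preceq> x [^] n" "n > 0" "x \<in> carrier G"
  shows "of_int m / of_int n \<le> ratio x"
  unfolding ratio_def
proof (rule cSup_upper)
  \<comment> \<open>The supremum is meaningful only for a bounded set. By \<open>cut_le\<close> any
    one upper fraction bounds all lower ones; here it is (k + 1)/1.\<close>
  obtain k where "x [^] (1::int) \<preceq> u [^] (k + 1 :: int)" using unit_floor assms(3) by (metis int_pow_1)
  then show "bdd_above {real_of_int m / of_int n | m n. n > 0 \<and> u [^] m \<preceq> x [^] n}"
    using cut_le assms(3) by (intro bdd_aboveI[of _ "of_int (k + 1) / of_int 1"]) fastforce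
qed (use assms in auto)

lemma ratio_upper:
  fixes m n :: int
  assumes "x [^] n \<preceq> u [^] m" "n > 0" "x \<in> carrier G"
  shows "ratio x \<le> of_int m / of_int n"
  unfolding ratio_def
proof (rule cSup_least)
  obtain k where "u [^] (k :: int) \<preceq> x [^] (1::int)" using unit_floor assms(3) by (metis int_pow_1)
  then show "{real_of_int m / of_int n | m n. n > 0 \<and> u [^] m \<preceq> x [^] n} \<noteq> {}"
    using zero_less_one by blast
qed (use cut_le assms in auto)

text \<open>Each denominator n confines the ratio to an interval of length 1/n whose ends come from
  inequalities in G. Additivity, monotonicity and uniqueness follow by letting n grow.\<close>

lemma ratio_floor:
  assumes x: "x \<in> carrier G" and n: "n > 0"
  obtains i :: int where "u [^] i \<preceq> x [^] (n::int)" "x [^] n \<preceq> u [^] (i + 1)"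
    "of_int i / of_int n \<le> ratio x" "ratio x \<le> of_int i / of_int n + 1 / of_int n"
proof -
  obtain i :: int where i: "u [^] i \<preceq> x [^] n" "x [^] n \<preceq> u [^] (i + 1)"
    using unit_floor[of "x [^] n"] x by auto
  then show thesis
    using that[OF i ratio_lower[OF i(1) n x]] ratio_upper[OF i(2) n x] by (simp add: add_divide_distrib)
qed

lemma ratio_mult:
  assumes xy: "x \<in> carrier G" "y \<in> carrier G"
  shows "ratio (x \<otimes> y) = ratio x + ratio y"
proof -
  have "ratio (x \<otimes> y) - ratio x - ratio y = 0"
  proof (rule zero_if_abs_le_fractions)
    fix n :: int assume n: "n > 0"
    obtain i where i: "u [^] i \<preceq> x [^] n" "x [^] n \<preceq> u [^] (i + 1)"
        "of_int i / of_int n \<le> ratio x" "ratio x \<le> of_int i / of_int n + 1 / of_int n"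
      using ratio_floor[OF xy(1) n] by blast
    obtain j where j: "u [^] j \<preceq> y [^] n" "y [^] n \<preceq> u [^] (j + 1)"
        "of_int j / of_int n \<le> ratio y" "ratio y \<le> of_int j / of_int n + 1 / of_int n"
      using ratio_floor[OF xy(2) n] by blast
    \<comment> \<open>The ratio of the sum and the sum of the ratios both lie between (i + j)/n and
      (i + j + 2)/n.\<close>
    have "u [^] (i + j) \<preceq> (x \<otimes> y) [^] n"
      using mult_mono[OF i(1) j(1)] xy unit_closed by (simp add: int_pow_mult int_pow_distrib)
    moreover have "(x \<otimes> y) [^] n \<preceq> u [^] ((i + 1) + (j + 1))"
      unfolding int_pow_distrib[OF xy] int_pow_mult[OF unit_closed, of "i + 1" "j + 1"]
      by (rule mult_mono[OF i(2) j(2)]) (use xy unit_closed in auto)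
    ultimately have "of_int (i + j) / of_int n \<le> ratio (x \<otimes> y)"
      "ratio (x \<otimes> y) \<le> of_int ((i + 1) + (j + 1)) / of_int n"
      using n xy by (blast intro: ratio_lower ratio_upper m_closed)+
    with i(3,4) j(3,4)
    show "\<bar>ratio (x \<otimes> y) - ratio x - ratio y\<bar> \<le> 2 / of_int n"
      by (simp add: add_divide_distrib abs_le_iff)
  qed
  then show ?thesis by simp
qed

lemma ratio_mono:
  assumes "x \<preceq> y" "x \<in> carrier G" "y \<in> carrier G"
  shows "ratio x \<le> ratio y"
proof -
  have "ratio x - ratio y \<le> 1 / of_int n" if n: "n > 0" for n :: int
  proof -
    obtain i where i: "u [^] i \<preceq> x [^] n" "ratio x \<le> of_int i / of_int n + 1 / of_int n"
      using ratio_floor[OF assms(2) n] by blast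
    have "u [^] i \<preceq> y [^] n"
      using le_trans[OF i(1) int_pow_mono[OF assms]] assms n unit_closed by simp
    from ratio_lower[OF this n assms(3)] i(2) show ?thesis by simp
  qed
  \<comment> \<open>Only an upper bound on the difference is known, so the limit argument is applied
    to its positive part.\<close>
  then have "max (ratio x - ratio y) 0 = 0"
    by (intro zero_if_abs_le_fractions[of _ 1]) simp
  then show ?thesis by simp
qed

lemma ratio_unit: "ratio u = 1"
  using ratio_lower[of 1 u 1] ratio_upper[of u 1 1] unit_closed by simp

text \<open>Absence of infinitesimals gives u <= n x, so 1/n is one of the lower fractions of x. The
  case n = 0 would say u <= 0.\<close>

lemma ratio_pos:
  assumes x: "x \<in> carrier G" "\<one> \<preceq> x" "x \<noteq> \<one>"
  shows "ratio x > 0"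
proof -
  obtain n :: nat where n: "u \<preceq> x [^] n" using no_infinitesimal[OF x] by auto
  have "n \<noteq> 0"
    using n unit_nonneg unit_nontrivial le_antisym[of u \<one>] unit_closed by (intro notI) auto
  then have "of_int 1 / of_int (int n) \<le> ratio x"
    using n x unit_closed by (intro ratio_lower) (simp_all add: int_pow_int)
  then show ?thesis using \<open>n \<noteq> 0\<close> by (auto elim!: less_le_trans[rotated])
qed

lemma ratio_inj: "inj_on ratio (carrier G)"
proof (rule inj_onI)
  have le: "y = x" if "x \<in> carrier G" "y \<in> carrier G" "ratio x = ratio y" "x \<preceq> y" for x y
  proof (rule ccontr)
    assume "y \<noteq> x"
    have "\<one> \<preceq> y \<otimes> inv x" using that le_shift_right[of \<one> y x] by simp
    moreover have "y \<otimes> inv x \<noteq> \<one>"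
      using \<open>y \<noteq> x\<close> that inv_equality[of y "inv x"] by auto
    ultimately have "ratio (y \<otimes> inv x) > 0" using that by (intro ratio_pos) auto
    moreover have "ratio (y \<otimes> inv x) + ratio x = ratio y"
      using that ratio_mult[of "y \<otimes> inv x" x] by (simp add: m_assoc)
    ultimately show False using that by simp
  qed
  show "x = y" if "x \<in> carrier G" "y \<in> carrier G" "ratio x = ratio y" for x y
    using total[OF that(1,2)] le[of x y] le[of y x] that by auto
qed

text \<open>Applying \<open>e\<close> to i u <= n x <= (i + 1) u confines e x to the same interval
  of length 1/n as the ratio.\<close>

lemma ratio_unique:
  assumes add: "\<And>x y. \<lbrakk>x \<in> carrier G; y \<in> carrier G\<rbrakk> \<Longrightarrow> e (x \<otimes> y) = e x + e y"
    and mono: "\<And>x y. \<lbrakk>x \<in> carrier G; y \<in> carrier G; x \<preceq> y\<rbrakk> \<Longrightarrow> e x \<le> (e y :: real)"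
    and unit: "e u = 1" and x: "x \<in> carrier G"
  shows "e x = ratio x"
proof -
  have one: "e \<one> = 0" using add[of \<one> \<one>] by simp
  have inv: "e (inv z) = - e z" if "z \<in> carrier G" for z
    using add[of z "inv z"] that one by simp
  have nat: "e (z [^] (n::nat)) = n * e z" if "z \<in> carrier G" for z n
    using that by (induction n) (auto simp: one add algebra_simps)
  have pow: "e (z [^] (k::int)) = k * e z" if "z \<in> carrier G" for z k
    using that by (cases k rule: int_cases2) (simp_all add: int_pow_int int_pow_neg_int nat inv)
  have "e x - ratio x = 0"
  proof (rule zero_if_abs_le_fractions)
    fix n :: int assume n: "n > 0"
    obtain i where i: "u [^] i \<preceq> x [^] n" "x [^] n \<preceq> u [^] (i + 1)"
        "of_int i / of_int n \<le> ratio x" "ratio x \<le> of_int i / of_int n + 1 / of_int n"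
      using ratio_floor[OF x n] by blast
    have "of_int i \<le> of_int n * e x" "of_int n * e x \<le> of_int (i + 1)"
      using mono[OF _ _ i(1)] mono[OF _ _ i(2)] x unit_closed by (simp_all add: pow unit)
    then have "of_int i / of_int n \<le> e x" "e x \<le> of_int (i + 1) / of_int n"
      using n by (simp_all add: field_simps)
    with i(3,4)
    show "\<bar>e x - ratio x\<bar> \<le> 1 / of_int n"
      by (simp add: add_divide_distrib abs_le_iff)
  qed
  then show ?thesis by simp
qed

section \<open>The embedding into the reals and its uniqueness\<close>

lemma lhom_real_mono:
  assumes e: "e \<in> lhom G real_lgroup" and "x \<preceq> y" "x \<in> carrier G" "y \<in> carrier G"
  shows "e x \<le> e y"
proof -
  have "jn x y = y" using assms by (intro ord.join_eqI) auto
  moreover have "e (jn x y) = max (e x) (e y)"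
    using e assms by (auto simp: lhom_def join_pres_def real_lgroup_join)
  ultimately show ?thesis by simp
qed

lemma lhom_real_mult:
  "\<lbrakk>e \<in> lhom G real_lgroup; x \<in> carrier G; y \<in> carrier G\<rbrakk> \<Longrightarrow> e (x \<otimes> y) = e x + e y"
  by (auto simp: lhom_def hom_def)

theorem holder_embedding:
  "\<exists>!e. e \<in> extensional (carrier G) \<and> e \<in> lhom G real_lgroup \<and> inj_on e (carrier G) \<and> e u = 1"
proof (rule ex1I)
  define e where "e = restrict ratio (carrier G)"
  \<comment> \<open>In a chain the join and the meet are the two elements themselves, so
    monotonicity already preserves both.\<close>
  have jm: "ratio (jn x y) = max (ratio x) (ratio y) \<and> ratio (mt x y) = min (ratio x) (ratio y)"
    if xy: "x \<in> carrier G" "y \<in> carrier G" for x y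
    using total[OF xy]
  proof
    assume "x \<preceq> y"
    moreover from this have "jn x y = y" "mt x y = x"
      using xy by (auto intro!: ord.join_eqI ord.meet_eqI)
    ultimately show ?thesis using xy ratio_mono[of x y] by simp
  next
    assume "y \<preceq> x"
    moreover from this have "jn x y = x" "mt x y = y"
      using xy by (auto intro!: ord.join_eqI ord.meet_eqI)
    ultimately show ?thesis using xy ratio_mono[of y x] by simp
  qed
  then have "e \<in> lhom G real_lgroup"
    using is_lattice lattice_real_lgroup
    by (auto simp: e_def lhom_def hom_def join_pres_def meet_pres_def real_lgroup_join
        real_lgroup_meet ratio_mult)
  then show "e \<in> extensional (carrier G) \<and> e \<in> lhom G real_lgroup \<and> inj_on e (carrier G) \<and> e u = 1"
    using ratio_inj unit_closed by (auto simp: e_def ratio_unit inj_on_restrict_eq)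
  fix f
  assume f: "f \<in> extensional (carrier G) \<and> f \<in> lhom G real_lgroup
    \<and> inj_on f (carrier G) \<and> f u = 1"
  show "f = e"
  proof (rule extensionalityI[of _ "carrier G"])
    show "f x = e x" if "x \<in> carrier G" for x
      using ratio_unique[of f x] f lhom_real_mono lhom_real_mult that by (simp add: e_def)
  qed (use f in \<open>auto simp: e_def\<close>)
qed

end

context wstar
begin

section \<open>Real values at the points of the Yosida space\<close>

lemma holder_quotient:
  assumes M: "M \<in> yosida_points G u"
  shows "holder (lquotient G M) (M #> u)"
proof -
  note I = yosida_points_lideal[OF M]
  interpret Q: abelian_lgroup "lquotient G M" by (rule abelian_lgroup_lquotient[OF I])
  show ?thesis
  proof unfold_locales
    show "ole (lquotient G M) x y \<or> ole (lquotient G M) y x"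
      if "x \<in> carrier (lquotient G M)" "y \<in> carrier (lquotient G M)" for x y
    proof -
      obtain a b where ab: "a \<in> carrier G" "x = M #> a" "b \<in> carrier G" "y = M #> b"
        using \<open>x \<in> carrier (lquotient G M)\<close> \<open>y \<in> carrier (lquotient G M)\<close>
        by (auto elim!: rcosetsE[OF I])
      have "(\<exists>m\<in>M. a \<otimes> inv b \<preceq> m) \<or> (\<exists>m\<in>M. b \<otimes> inv a \<preceq> m)"
        using yosida_point_total[OF M, of "a \<otimes> inv b"] ab by (simp add: inv_mult m_comm)
      then have "(\<exists>m\<in>M. a \<preceq> m \<otimes> b) \<or> (\<exists>m\<in>M. b \<preceq> m \<otimes> a)"
        using ab lideal_carrier[OF I] inv_shift_right by blast
      then show ?thesis using ab coset_le_iff[OF I] by simp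
    qed
    show "M #> u \<in> carrier (lquotient G M)" using unit_closed coset_closed[OF I] by simp
    show "ole (lquotient G M) \<one>\<^bsub>lquotient G M\<^esub> (M #> u)"
      using coset_mono[OF I unit_nonneg one_closed unit_closed] coset_one[OF I] by simp
    show "M #> u \<noteq> \<one>\<^bsub>lquotient G M\<^esub>"
      using coset_self_iff[OF I unit_closed] yosida_points_unit[OF M] by simp
    show "\<exists>n::nat. ole (lquotient G M) x ((M #> u) [^]\<^bsub>lquotient G M\<^esub> n)"
      if x: "x \<in> carrier (lquotient G M)" for x
    proof -
      obtain a where a: "a \<in> carrier G" "x = M #> a" using x by (auto elim!: rcosetsE[OF I])
      obtain n :: nat where "a \<preceq> u [^] n" using unit_bound[OF a(1)] by blast
      then have "ole (lquotient G M) x (M #> (u [^] n))"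
        unfolding a(2) using a unit_closed by (intro coset_mono[OF I]) auto
      then show ?thesis using coset_pow[OF I unit_closed] by metis
    qed
    show "\<exists>n::nat. ole (lquotient G M) (M #> u) (x [^]\<^bsub>lquotient G M\<^esub> n)"
      if x: "x \<in> carrier (lquotient G M)" "ole (lquotient G M) \<one>\<^bsub>lquotient G M\<^esub> x"
        "x \<noteq> \<one>\<^bsub>lquotient G M\<^esub>" for x
    proof -
      obtain a where a: "a \<in> carrier G" "x = M #> a" using x(1) by (auto elim!: rcosetsE[OF I])
      have "ole (lquotient G M) (M #> \<one>) (M #> a)" using x(2) a coset_one[OF I] by simp
      then obtain k where k: "k \<in> M" "\<one> \<preceq> k \<otimes> a"
        using coset_le_iff[OF I one_closed a(1)] by blast
      \<comment> \<open>A positive coset need not have the positive representative a, but a + k is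
        one. Positivity in G itself is required before adjoining it to M.\<close>
      define b where "b = k \<otimes> a"
      have b: "b \<in> carrier G" "\<one> \<preceq> b" "x = M #> b"
        using k a lideal_carrier[OF I] coset_eq_iff[OF I, of b a] by (auto simp: b_def)
      have "b \<notin> M" using x(3) b coset_self_iff[OF I] by auto
      then obtain n :: nat and m where "m \<in> M" "u \<preceq> b [^] n \<otimes> m"
        using unit_le_outside[OF M b(1,2)] by blast
      then have "ole (lquotient G M) (M #> u) (M #> (b [^] n))"
        unfolding coset_le_iff[OF I unit_closed nat_pow_closed[OF b(1)]]
        using b lideal_carrier[OF I] by (intro bexI[of _ m]) (auto simp: m_comm)
      then show ?thesis using coset_pow[OF I b(1)] b(3) by metis
    qed
  qed
qed

context
  fixes M assumes M: "M \<in> yosida_points G u"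
begin

interpretation Q: holder "lquotient G M" "M #> u"
  by (rule holder_quotient[OF M])

lemma yosida_embedding_props:
  "yosida_embedding G u M \<in> lhom (lquotient G M) real_lgroup"
  "inj_on (yosida_embedding G u M) (carrier (lquotient G M))"
  using theI'[OF Q.holder_embedding] by (auto simp: yosida_embedding_def)

lemma yosida_val_mult: "\<lbrakk>f \<in> carrier G; g \<in> carrier G\<rbrakk> \<Longrightarrow>
    yosida_val G u (f \<otimes> g) M = yosida_val G u f M + yosida_val G u g M"
  using Q.lhom_real_mult[OF yosida_embedding_props(1), of "M #> f" "M #> g"]
  by (simp add: yosida_val_def coset_mult[OF yosida_points_lideal[OF M], simplified]
      coset_closed[OF yosida_points_lideal[OF M]])

lemma yosida_val_mono:
  "\<lbrakk>ole (lquotient G M) (M #> f) (M #> g); f \<in> carrier G; g \<in> carrier G\<rbrakk> \<Longrightarrow>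
    yosida_val G u f M \<le> yosida_val G u g M"
  using Q.lhom_real_mono[OF yosida_embedding_props(1), of "M #> f" "M #> g"]
  by (simp add: yosida_val_def coset_closed[OF yosida_points_lideal[OF M]])

lemma yosida_val_one: "yosida_val G u \<one> M = 0"
  using yosida_val_mult[of \<one> \<one>] by simp

lemma yosida_val_pow:
  "f \<in> carrier G \<Longrightarrow> yosida_val G u (f [^] (n::nat)) M = n * yosida_val G u f M"
  by (induction n) (auto simp: yosida_val_one yosida_val_mult algebra_simps)

text \<open>The zero coset has value 0 and the embedding is injective, so value 0 singles out the
  coset M. Zero and cozero sets thereby become membership conditions.\<close>

lemma yosida_val_eq_0_iff: "f \<in> carrier G \<Longrightarrow> yosida_val G u f M = 0 \<longleftrightarrow> f \<in> M"
  using inj_on_eq_iff[OF yosida_embedding_props(2), of "M #> f" "M #> \<one>"] yosida_val_one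
    coset_self_iff[OF yosida_points_lideal[OF M]] coset_closed[OF yosida_points_lideal[OF M]]
    coset_closed[OF yosida_points_lideal[OF M] one_closed]
  by (simp add: yosida_val_def coset_one[OF yosida_points_lideal[OF M]])

end

end

section \<open>The equivalences\<close>

context wstar
begin

lemma zero_set_eq: "g \<in> carrier G \<Longrightarrow> zero_set G u g = {M \<in> yosida_points G u. g \<in> M}"
  and coz_eq: "g \<in> carrier G \<Longrightarrow> coz G u g = {M \<in> yosida_points G u. g \<notin> M}"
  by (auto simp: zero_set_def coz_def yosida_val_eq_0_iff)

lemma vanishing_zero_set_eq: "g \<in> carrier G \<Longrightarrow> vanishing_lideal G u (zero_set G u g) =
    {f \<in> carrier G. \<forall>M\<in>yosida_points G u. g \<in> M \<longrightarrow> f \<in> M}"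
  by (auto simp: vanishing_lideal_def zero_set_eq)

lemma principal_lideal_subset_vanishing:
  "g \<in> carrier G \<Longrightarrow> principal_lideal G g \<subseteq> vanishing_lideal G u (zero_set G u g)"
  using principal_lideal_least yosida_points_lideal
  by (auto simp: vanishing_zero_set_eq principal_lideal_def)

text \<open>The embedding into a power of the reals is used one coordinate at a time: an inequality
  modulo K persists modulo each M above K, hence between values at M. There n a(M) <= b(M) for all n
  forces a(M) <= 0, and positivity of a modulo K gives a(M) = 0.\<close>

lemma archimedean_lquotient_Inter:
  assumes K: "lideal G K"
    and Inter: "\<And>f. \<lbrakk>f \<in> carrier G; \<And>M. \<lbrakk>M \<in> yosida_points G u; K \<subseteq> M\<rbrakk> \<Longrightarrow> f \<in> M\<rbrakk> \<Longrightarrow> f \<in> K"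
  shows "archimedean_lgroup (lquotient G K)"
proof (rule archimedean_lquotientI[OF K])
  fix a b
  assume ab: "a \<in> carrier G" "b \<in> carrier G"
    and pos: "ole (lquotient G K) K (K #> a)"
    and bound: "\<And>n::nat. ole (lquotient G K) (K #> (a [^] n)) (K #> b)"
  show "a \<in> K"
  proof (rule Inter[OF ab(1)])
    fix M assume M: "M \<in> yosida_points G u" "K \<subseteq> M"
    note I = yosida_points_lideal[OF M(1)]
    have le: "yosida_val G u x M \<le> yosida_val G u y M"
      if "ole (lquotient G K) (K #> x) (K #> y)" "x \<in> carrier G" "y \<in> carrier G" for x y
      using that coset_le_iff[OF K that(2,3)] coset_le_iff[OF I that(2,3)] M(2)
      by (intro yosida_val_mono[OF M(1)]) blast+
    have "0 \<le> yosida_val G u a M"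
      using le[of \<one> a] pos ab coset_one[OF K] yosida_val_one[OF M(1)] by simp
    moreover have "n * yosida_val G u a M \<le> yosida_val G u b M" for n :: nat
      using le[OF bound[of n]] ab yosida_val_pow[OF M(1)] by simp
    then have "\<not> 0 < yosida_val G u a M"
      using ex_less_of_nat_mult[of "yosida_val G u a M" "yosida_val G u b M"] by (meson not_le)
    ultimately show "a \<in> M" using yosida_val_eq_0_iff[OF M(1) ab(1)] by simp
  qed
qed

text \<open>The map induced on G/K preserves order and sends only the zero coset to 0, so a bounded
  set of multiples in G/K becomes one in the Archimedean group H.\<close>

lemma archimedean_lquotient_kernel:
  assumes K: "lideal G K" and ker: "wstar_kernel G u K"
  shows "archimedean_lgroup (lquotient G K)"
proof -
  obtain H :: "'a set ogroup" and v h where H: "wstar H v" and h: "h \<in> wstar_hom G u H v"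
    and Kh: "K = kernel G H h"
    using ker by (auto simp: wstar_kernel_def)
  interpret H: wstar H v by (rule H)
  have hj: "h (jn x y) = H.jn (h x) (h y)" if "x \<in> carrier G" "y \<in> carrier G" for x y
    using h that by (auto simp: wstar_hom_def lhom_def join_pres_def)
  interpret h: group_hom G H h
    using h by unfold_locales (auto simp: wstar_hom_def lhom_def)
  have le: "ole H (h x) (h y)"
    if xy: "x \<in> carrier G" "y \<in> carrier G" and quot: "ole (lquotient G K) (K #> x) (K #> y)" for x y
  proof -
    obtain k where k: "k \<in> carrier G" "h k = \<one>\<^bsub>H\<^esub>" "x \<preceq> k \<otimes> y"
      using quot unfolding coset_le_iff[OF K xy] by (auto simp: Kh kernel_def)
    \<comment> \<open>The inequality is encoded as a join, which h preserves, while h sends k to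
      0.\<close>
    then have "jn x (k \<otimes> y) = k \<otimes> y" using xy by (intro ord.join_eqI) auto
    then have "H.jn (h x) (h y) = h y" using hj[of x "k \<otimes> y"] k xy by simp
    then show ?thesis using H.jn_ub1[of "h x" "h y"] xy by simp
  qed
  show ?thesis
  proof (rule archimedean_lquotientI[OF K])
    fix a b
    assume ab: "a \<in> carrier G" "b \<in> carrier G"
      and pos: "ole (lquotient G K) K (K #> a)"
      and bound: "\<And>n::nat. ole (lquotient G K) (K #> (a [^] n)) (K #> b)"
    have "ole H \<one>\<^bsub>H\<^esub> (h a)" using le[of \<one> a] pos ab coset_one[OF K] by simp
    moreover have "ole H (h a [^]\<^bsub>H\<^esub> n) (h b)" for n :: nat
      using le[OF _ _ bound[of n]] ab by (simp add: h.hom_nat_pow)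
    ultimately have "h a = \<one>\<^bsub>H\<^esub>" using H.archimedean[of "h a" "h b"] ab by simp
    then show "a \<in> K" using ab by (simp add: Kh kernel_def)
  qed
qed

lemma wstar_lquotient:
  assumes K: "lideal G K" and arch: "archimedean_lgroup (lquotient G K)"
  shows "wstar (lquotient G K) (K #> u)"
proof -
  interpret Q: archimedean_lgroup "lquotient G K" by (rule arch)
  have closed: "K #> u \<in> carrier (lquotient G K)"
    using coset_closed[OF K unit_closed] by simp
  have nonneg: "ole (lquotient G K) \<one>\<^bsub>lquotient G K\<^esub> (K #> u)"
    using coset_mono[OF K unit_nonneg one_closed unit_closed] coset_one[OF K] by simp
  have "A \<in> principal_lideal (lquotient G K) (K #> u)" if A: "A \<in> carrier (lquotient G K)" for A
  proof -
    obtain a where a: "a \<in> carrier G" "A = K #> a" using A by (auto elim!: rcosetsE[OF K])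
    obtain n :: nat where n: "n > 0" "a \<preceq> u [^] n" "inv a \<preceq> u [^] n" using unit_bound[OF a(1)] .
    \<comment> \<open>The bounds on a and -a descend separately, so the absolute value of the coset
      A need not be computed.\<close>
    have "ole (lquotient G K) A ((K #> u) [^]\<^bsub>lquotient G K\<^esub> n)"
      "ole (lquotient G K) (inv\<^bsub>lquotient G K\<^esub> A) ((K #> u) [^]\<^bsub>lquotient G K\<^esub> n)"
      unfolding a(2) coset_inv[OF K a(1)] coset_pow[OF K unit_closed]
      using n a unit_closed by (auto intro!: coset_mono[OF K] simp del: lquotient_simps)
    then show ?thesis
      using A n(1) Q.mem_principal_lideal_iff[OF closed] Q.labs_of_one_le[OF closed nonneg] by auto
  qed
  then show ?thesis
    using closed nonneg
    by unfold_locales (auto simp: principal_lideal_def simp del: lquotient_simps)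
qed

text \<open>For the converse of the preceding kernel argument, the quotient map is itself the
  morphism: cosets have type \<open>'a set\<close>, so \<open>lquotient G K\<close> is among the
  codomains that \<open>wstar_kernel\<close> admits.\<close>

lemma wstar_kernel_iff:
  assumes K: "lideal G K"
  shows "wstar_kernel G u K \<longleftrightarrow> archimedean_lgroup (lquotient G K)"
proof
  assume "archimedean_lgroup (lquotient G K)"
  then have "wstar (lquotient G K) (K #> u)" by (rule wstar_lquotient[OF K])
  moreover have "(\<lambda>a. K #> a) \<in> wstar_hom G u (lquotient G K) (K #> u)"
    using coset_lhom[OF K] by (simp add: wstar_hom_def)
  moreover have "K = kernel G (lquotient G K) (\<lambda>a. K #> a)"
    using coset_self_iff[OF K] lideal_carrier[OF K] by (auto simp: kernel_def)
  ultimately show "wstar_kernel G u K" unfolding wstar_kernel_def by blast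
qed (rule archimedean_lquotient_kernel[OF K])

end

theorem theorem2p1:
  fixes G :: "('a, 'm) ogroup_scheme" and u :: 'a
  assumes "wstar G u"
  shows "(class_Y G
           \<longleftrightarrow> (\<forall>g\<in>carrier G. principal_lideal G g = vanishing_lideal G u (zero_set G u g)))
       \<and> ((\<forall>g\<in>carrier G. principal_lideal G g = vanishing_lideal G u (zero_set G u g))
           \<longleftrightarrow> (\<forall>g\<in>carrier G. wstar_kernel G u (principal_lideal G g)))
       \<and> ((\<forall>g\<in>carrier G. wstar_kernel G u (principal_lideal G g))
           \<longleftrightarrow> (\<forall>g\<in>carrier G. archimedean_lgroup (lquotient G (principal_lideal G g))))
       \<and> ((\<forall>g\<in>carrier G. archimedean_lgroup (lquotient G (principal_lideal G g)))
           \<longleftrightarrow> (\<forall>f\<in>carrier G. \<forall>g\<in>carrier G.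
                 coz G u f \<subseteq> coz G u g \<longrightarrow> f \<in> principal_lideal G g))"
proof -
  interpret wstar G u by (rule assms)
  let ?P = "principal_lideal G" and ?V = "\<lambda>g. vanishing_lideal G u (zero_set G u g)"
  have P_sub_iff: "?P g \<subseteq> M \<longleftrightarrow> g \<in> M" if "M \<in> yosida_points G u" "g \<in> carrier G" for g M
    using principal_lideal_least[OF yosida_points_lideal[OF that(1)]]
      mem_own_principal_lideal[OF that(2)] by blast
  have sub: "?P g \<subseteq> ?V g" if "g \<in> carrier G" for g
    using principal_lideal_subset_vanishing that .
  \<comment> \<open>A family of maximal ideals that cuts out G(g) consists of ideals containing g.
    Enlarging it to all such ideals therefore does not shrink the intersection, which becomes
    I(Z(g)).\<close>
  have Y2: "(\<exists>\<M>. \<M> \<subseteq> {M. maximal_lideal G M} \<and> ?P g = carrier G \<inter> \<Inter>\<M>) \<longleftrightarrow> ?P g = ?V g"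
    if g: "g \<in> carrier G" for g
  proof
    assume "\<exists>\<M>. \<M> \<subseteq> {M. maximal_lideal G M} \<and> ?P g = carrier G \<inter> \<Inter>\<M>"
    then obtain \<M> where \<M>: "\<M> \<subseteq> yosida_points G u" "?P g = carrier G \<inter> \<Inter>\<M>"
      by (auto simp: yosida_points_eq_maximal)
    moreover from \<M> have "g \<in> M" if "M \<in> \<M>" for M
      using mem_own_principal_lideal[OF g] that by blast
    ultimately have "?V g \<subseteq> ?P g" using g by (auto simp: vanishing_zero_set_eq)
    with sub[OF g] show "?P g = ?V g" by blast
  next
    assume "?P g = ?V g"
    then show "\<exists>\<M>. \<M> \<subseteq> {M. maximal_lideal G M} \<and> ?P g = carrier G \<inter> \<Inter>\<M>"
      using g by (intro exI[of _ "{M \<in> yosida_points G u. g \<in> M}"])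
        (auto simp: yosida_points_eq_maximal vanishing_zero_set_eq)
  qed
  have "?P g = ?V g \<longleftrightarrow> archimedean_lgroup (lquotient G (?P g))" if g: "g \<in> carrier G" for g
  proof
    assume eq: "?P g = ?V g"
    show "archimedean_lgroup (lquotient G (?P g))"
    proof (rule archimedean_lquotient_Inter[OF lideal_principal_lideal[OF g]])
      show "f \<in> ?P g"
        if "f \<in> carrier G" "\<And>M. \<lbrakk>M \<in> yosida_points G u; ?P g \<subseteq> M\<rbrakk> \<Longrightarrow> f \<in> M" for f
        using that P_sub_iff[OF _ g] by (simp add: eq vanishing_zero_set_eq[OF g])
    qed
  next
    assume arch: "archimedean_lgroup (lquotient G (?P g))"
    have "f \<in> ?P g" if f: "f \<in> ?V g" for f
    proof (rule ccontr)
      have fV: "f \<in> carrier G" "\<And>M. \<lbrakk>M \<in> yosida_points G u; g \<in> M\<rbrakk> \<Longrightarrow> f \<in> M"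
        using f by (auto simp: vanishing_zero_set_eq[OF g])
      assume "f \<notin> ?P g"
      then obtain M where "M \<in> yosida_points G u" "?P g \<subseteq> M" "f \<notin> M"
        using archimedean_quotient_separates[OF lideal_principal_lideal[OF g] arch fV(1)] by blast
      then show False using fV(2) P_sub_iff[OF _ g] by blast
    qed
    with sub[OF g] show "?P g = ?V g" by blast
  qed
  moreover have "?P g = ?V g \<longleftrightarrow> (\<forall>f\<in>carrier G. coz G u f \<subseteq> coz G u g \<longrightarrow> f \<in> ?P g)"
    if g: "g \<in> carrier G" for g
  proof -
    \<comment> \<open>By contraposition, every point containing g contains f.\<close>
    have "coz G u f \<subseteq> coz G u g \<longleftrightarrow> f \<in> ?V g" if "f \<in> carrier G" for f
      using that g by (auto simp: coz_eq vanishing_zero_set_eq)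
    moreover have "?V g \<subseteq> carrier G" by (auto simp: vanishing_lideal_def)
    ultimately show ?thesis using sub[OF g] by blast
  qed
  \<comment> \<open>The quantifiers are exchanged so that g comes first and the equivalence for
    fixed g applies.\<close>
  moreover have "(\<forall>f\<in>carrier G. \<forall>g\<in>carrier G. coz G u f \<subseteq> coz G u g \<longrightarrow> f \<in> ?P g) \<longleftrightarrow>
      (\<forall>g\<in>carrier G. \<forall>f\<in>carrier G. coz G u f \<subseteq> coz G u g \<longrightarrow> f \<in> ?P g)"
    by blast
  ultimately show ?thesis
    unfolding class_Y_def
    by (simp only: Y2 wstar_kernel_iff[OF lideal_principal_lideal] cong: ball_cong)
qed

end
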